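(* Let $(G,\theta)$ be a measured group. If $(G,\theta)$ admits an ergodic stationary $(G,\theta)$-space of type $\mathrm{III}_1$, then for every $0\le\lambda\le1$ it admits an ergodic stationary $(G,\theta)$-space of type $\mathrm{III}_\lambda$.
   Context: A measured group $(G,\theta)$ is a locally compact second countable (lcsc) group $G$ with an admissible Borel probability measure $\theta$, i.e. $\theta$ is absolutely continuous with respect to Haar measure and is not supported on a closed proper subsemigroup of $G$. A stationary $(G,\theta)$-space is a standard Borel space $X$ with a Borel $G$-action and a Borel probability measure $\mu$ with $\int_G g\mu\,d\theta(g)=\mu$, where $g\mu(A)=\mu(g^{-1}.A)$; then $g\mu\sim\mu$ for all $g$. It is ergodic if every $G$-invariant (mod $\mu$) measurable function is constant $\mu$-a.e. Types. Let $(X,\mu)$ be an ergodic nonsingular $G$-space (i.e. $g\mu\sim\mu$ for all $g$). Let $\varpi:G\times X\to\mathbb{R}_{>0}$ be a measurable map with $\varpi_g=\frac{dg^{-1}\mu}{d\mu}$ $\mu$-a.e. for every $g$ and $\varpi_{gh}(x)=\varpi_g(h.x)\varpi_h(x)$ everywhere (such a strict version exists), and put $\alpha=-\log\varpi$. The Maharam extension is the $G$-action $g.(x,t)=(g.x,t+\alpha_g(x))$ on $X\times\mathbb{R}$, with the measure class of $\mu\otimes\mathrm{Lebesgue}$. It commutes with the $\mathbb{R}$-action $s.(x,t)=(x,t+s)$, so $\mathbb{R}$ acts on the space of ergodic components of the Maharam extension (equivalently on the algebra $L^\infty(X\times\mathbb{R})^G$ of $G$-invariant functions); this ergodic $\mathbb{R}$-action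 is the Krieger associated flow. $(X,\mu)$ is of type $\mathrm{III}$ if there is no nonzero $G$-invariant $\sigma$-finite measure absolutely continuous with respect to $\mu$. A type $\mathrm{III}$ space is of type $\mathrm{III}_1$ if the associated flow is trivial (on one point), equivalently the Maharam extension is ergodic; of type $\mathrm{III}_\lambda$, $0<\lambda<1$, if the associated flow is the periodic (translation) flow on $[0,-\log\lambda)$; and of type $\mathrm{III}_0$ if the associated flow is properly ergodic (non-transitive). *)

theory Defs
  imports "HOL-Probability.Probability" "HOL-Library.Real_Mod"
begin

(* Groups are written additively because the library's class of topological groups,
   topological_group_add, is additive.  The class does not assume commutativity:
   g + h stands for the product gh, 0 for the identity and - g for the inverse of g. *)

definition haar_measure :: "'g::{topological_group_add, second_countable_topology, t2_space} measure \<Rightarrow> bool" where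
  "haar_measure H \<longleftrightarrow>
     sets H = sets borel \<and>
     (\<forall>g. distr H H (\<lambda>h. g + h) = H) \<and>
     (\<forall>K. compact K \<longrightarrow> emeasure H K < \<infinity>) \<and>
     emeasure H UNIV \<noteq> 0"

definition admissible :: "'g::{topological_group_add, second_countable_topology, t2_space} measure \<Rightarrow> bool" where
  "admissible \<theta> \<longleftrightarrow>
     (\<exists>H. haar_measure H \<and> absolutely_continuous H \<theta>) \<and>
     \<not> (\<exists>S. closed S \<and> S \<noteq> UNIV \<and> (\<forall>g\<in>S. \<forall>h\<in>S. g + h \<in> S) \<and> (AE g in \<theta>. g \<in> S))"

definition measured_group :: "'g::{topological_group_add, second_countable_topology, t2_space} measure \<Rightarrow> bool" where
  "measured_group \<theta> \<longleftrightarrow>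
     locally_compact_space (euclidean :: 'g topology) \<and>
     prob_space \<theta> \<and> sets \<theta> = sets borel \<and> admissible \<theta>"

definition standard_borel :: "'x measure \<Rightarrow> bool" where
  "standard_borel M \<longleftrightarrow>
     (\<exists>T. completely_metrizable_space T \<and> second_countable T \<and>
          topspace T = space M \<and> sets M = sigma_sets (space M) {U. openin T U})"

definition borel_action :: "'x measure \<Rightarrow> ('g::{topological_group_add, second_countable_topology, t2_space} \<Rightarrow> 'x \<Rightarrow> 'x) \<Rightarrow> bool" where
  "borel_action M act \<longleftrightarrow>
     (\<lambda>(g, x). act g x) \<in> measurable (borel \<Otimes>\<^sub>M M) M \<and>
     (\<forall>x\<in>space M. act 0 x = x) \<and>
     (\<forall>g h. \<forall>x\<in>space M. act (g + h) x = act g (act h x))"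

definition stationary_space ::
  "'g::{topological_group_add, second_countable_topology, t2_space} measure \<Rightarrow> 'x measure \<Rightarrow> ('g \<Rightarrow> 'x \<Rightarrow> 'x) \<Rightarrow> bool" where
  "stationary_space \<theta> M act \<longleftrightarrow>
     standard_borel M \<and> prob_space M \<and> borel_action M act \<and>
     (\<forall>A\<in>sets M. (\<integral>\<^sup>+ g. emeasure (distr M M (act g)) A \<partial>\<theta>) = emeasure M A)"

definition invariant_mod :: "'x measure \<Rightarrow> ('g \<Rightarrow> 'x \<Rightarrow> 'x) \<Rightarrow> ('x \<Rightarrow> 'y) \<Rightarrow> bool" where
  "invariant_mod M act f \<longleftrightarrow> (\<forall>g. AE x in M. f (act g x) = f x)"

definition ergodic :: "'x measure \<Rightarrow> ('g \<Rightarrow> 'x \<Rightarrow> 'x) \<Rightarrow> bool" where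
  "ergodic M act \<longleftrightarrow>
     (\<forall>f :: 'x \<Rightarrow> real. f \<in> borel_measurable M \<longrightarrow> invariant_mod M act f \<longrightarrow>
        (\<exists>c. AE x in M. f x = c))"

definition class_preserving :: "'x measure \<Rightarrow> 'y measure \<Rightarrow> ('x \<Rightarrow> 'y) \<Rightarrow> bool" where
  "class_preserving M N f \<longleftrightarrow>
     f \<in> measurable M N \<and> null_sets (distr M N f) = null_sets N"

definition nonsingular_action :: "'x measure \<Rightarrow> ('g::{topological_group_add, second_countable_topology, t2_space} \<Rightarrow> 'x \<Rightarrow> 'x) \<Rightarrow> bool" where
  "nonsingular_action M act \<longleftrightarrow>
     borel_action M act \<and> (\<forall>g. class_preserving M M (act g))"

definition strict_rn_cocycle ::
  "'x measure \<Rightarrow> ('g::{topological_group_add, second_countable_topology, t2_space} \<Rightarrow> 'x \<Rightarrow> 'x) \<Rightarrow> ('g \<Rightarrow> 'x \<Rightarrow> real) \<Rightarrow> bool" where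
  "strict_rn_cocycle M act \<omega> \<longleftrightarrow>
     (\<lambda>(g, x). \<omega> g x) \<in> borel_measurable (borel \<Otimes>\<^sub>M M) \<and>
     (\<forall>g. \<forall>x\<in>space M. 0 < \<omega> g x) \<and>
     (\<forall>g. AE x in M. ennreal (\<omega> g x) = RN_deriv M (distr M M (act (- g))) x) \<and>
     (\<forall>g h. \<forall>x\<in>space M. \<omega> (g + h) x = \<omega> g (act h x) * \<omega> h x)"

definition maharam_act :: "('g \<Rightarrow> 'x \<Rightarrow> 'x) \<Rightarrow> ('g \<Rightarrow> 'x \<Rightarrow> real) \<Rightarrow> 'g \<Rightarrow> 'x \<times> real \<Rightarrow> 'x \<times> real" where
  "maharam_act act \<omega> g = (\<lambda>(x, t). (act g x, t + (- ln (\<omega> g x))))"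

definition vertical_flow :: "real \<Rightarrow> 'x \<times> real \<Rightarrow> 'x \<times> real" where
  "vertical_flow s = (\<lambda>(x, t). (x, t + s))"

(* N with the flow on it is a space of ergodic components of the Maharam extension: the
   quotient map p pulls the bounded measurable functions on N back onto all of
   L^infinity(X x R)^G (modulo null sets), and carries the vertical flow to the flow on N.
   Every standard Borel space is isomorphic to one carried by a subset of the reals, so
   nothing is lost by taking the points of N to be reals. *)
definition associated_flow ::
  "'x measure \<Rightarrow> ('g::{topological_group_add, second_countable_topology, t2_space} \<Rightarrow> 'x \<Rightarrow> 'x) \<Rightarrow> ('g \<Rightarrow> 'x \<Rightarrow> real) \<Rightarrow>
     real measure \<Rightarrow> (real \<Rightarrow> real \<Rightarrow> real) \<Rightarrow> bool" where
  "associated_flow M act \<omega> N flow \<longleftrightarrow>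
     standard_borel N \<and> prob_space N \<and> nonsingular_action N flow \<and>
     (\<exists>p. class_preserving (M \<Otimes>\<^sub>M lborel) N p \<and>
          invariant_mod (M \<Otimes>\<^sub>M lborel) (maharam_act act \<omega>) p \<and>
          (\<forall>s. AE z in M \<Otimes>\<^sub>M lborel. p (vertical_flow s z) = flow s (p z)) \<and>
          (\<forall>f :: 'x \<times> real \<Rightarrow> real.
             f \<in> borel_measurable (M \<Otimes>\<^sub>M lborel) \<longrightarrow> bounded (f ` space (M \<Otimes>\<^sub>M lborel)) \<longrightarrow>
             invariant_mod (M \<Otimes>\<^sub>M lborel) (maharam_act act \<omega>) f \<longrightarrow>
             (\<exists>F \<in> borel_measurable N. AE z in M \<Otimes>\<^sub>M lborel. f z = F (p z))))"

definition flow_isomorphic ::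
  "'x measure \<Rightarrow> (real \<Rightarrow> 'x \<Rightarrow> 'x) \<Rightarrow> 'y measure \<Rightarrow> (real \<Rightarrow> 'y \<Rightarrow> 'y) \<Rightarrow> bool" where
  "flow_isomorphic M F N F' \<longleftrightarrow>
     (\<exists>\<phi> \<psi>. class_preserving M N \<phi> \<and> class_preserving N M \<psi> \<and>
            (AE x in M. \<psi> (\<phi> x) = x) \<and> (AE y in N. \<phi> (\<psi> y) = y) \<and>
            (\<forall>s. AE x in M. \<phi> (F s x) = F' s (\<phi> x)))"

definition trivial_flow :: "'x measure \<Rightarrow> bool" where
  "trivial_flow N \<longleftrightarrow> (\<exists>y\<in>space N. AE z in N. z = y)"

definition properly_ergodic_flow :: "'x measure \<Rightarrow> (real \<Rightarrow> 'x \<Rightarrow> 'x) \<Rightarrow> bool" where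
  "properly_ergodic_flow N flow \<longleftrightarrow>
     ergodic N flow \<and> \<not> (\<exists>y\<in>space N. AE z in N. z \<in> range (\<lambda>s. flow s y))"

definition type_III :: "'x measure \<Rightarrow> ('g \<Rightarrow> 'x \<Rightarrow> 'x) \<Rightarrow> bool" where
  "type_III M act \<longleftrightarrow>
     \<not> (\<exists>\<nu>. sets \<nu> = sets M \<and> sigma_finite_measure \<nu> \<and> absolutely_continuous M \<nu> \<and>
            (\<forall>g. distr \<nu> \<nu> (act g) = \<nu>) \<and> emeasure \<nu> (space M) \<noteq> 0)"

(* The strict cocycle exists and is unique up to null sets for each g, and the associated flow
   exists and is unique up to isomorphism; so the existential quantifier is only a choice of
   representatives. *)
definition type_III_sub ::
  "real \<Rightarrow> 'x measure \<Rightarrow> ('g::{topological_group_add, second_countable_topology, t2_space} \<Rightarrow> 'x \<Rightarrow> 'x) \<Rightarrow> bool" where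
  "type_III_sub \<kappa> M act \<longleftrightarrow>
     nonsingular_action M act \<and> ergodic M act \<and> type_III M act \<and>
     (\<exists>\<omega> N flow. strict_rn_cocycle M act \<omega> \<and> associated_flow M act \<omega> N flow \<and>
        ((\<kappa> = 1 \<and> trivial_flow N) \<or>
         (0 < \<kappa> \<and> \<kappa> < 1 \<and>
            flow_isomorphic N flow (restrict_space lborel {0..< - ln \<kappa>})
              (\<lambda>s y. (y + s) rmod (- ln \<kappa>))) \<or>
         (\<kappa> = 0 \<and> properly_ergodic_flow N flow)))"

end

theory Submission
  imports Defs "HOL-Analysis.Kronecker_Approximation_Theorem"
begin

text \<open>
  Let \<open>F\<close> be a probability-measure-preserving flow on \<open>(N, \<nu>)\<close> and let \<open>G\<close> act on \<open>M \<times> N\<close> by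
  \<open>g(x, y) = (gx, F\<^bsub>- \<alpha>\<^esub> y)\<close> with \<open>\<alpha> = \<alpha>\<^sub>g(x) = - ln (\<omega> g x)\<close>.  As \<open>F\<close> preserves \<open>\<nu>\<close>, the product
  measure is again stationary and has the same Radon-Nikodym cocycle.  On the Maharam extension, the
  coordinate \<open>F\<^sub>t y\<close> is invariant, and in the coordinates \<open>(x, t, F\<^sub>t y)\<close> the group acts only on
  \<open>(x, t)\<close>, by the Maharam extension of \<open>M\<close>.  That action is ergodic when \<open>M\<close> has type \<open>III\<^sub>1\<close>, so the
  associated flow of \<open>M \<times> N\<close> is \<open>F\<close> itself.  It remains to choose for \<open>F\<close> the flow on one point, the
  rotation of a circle, or an irrational linear flow on a torus.
\<close>

section \<open>The associated flow\<close>

text \<open>Invariance means, for each g separately, equality off a null set that depends on g, and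
  the group may be uncountable. So one cannot simply freeze the value of F_t y and apply ergodicity
  of the Maharam extension of \<open>M\<close> to the slice of an invariant function. Instead the
  function is integrated in that coordinate over an arbitrary measurable set B. The result is
  invariant on \<open>M \<Otimes>\<^sub>M lborel\<close>, hence constant, and the constants for all
  B together recover the function. Ergodicity and type III are not checked on the product itself:
  both are read off from its associated flow, the first from ergodicity of the flow, the second from
  its invariant probability measure. Maharam extensions carry infinite measures, so quotient maps
  are compared through null sets (\<open>class_preserving\<close>) and not through pushforwards.
  Products and tori are not measures on \<open>real\<close>, whereas \<open>associated_flow\<close>
  and the conclusion fix that type; this is why every notion is also shown to survive transport
  along an isomorphism.\<close>

lemma class_preservingI_distr:
  assumes "f \<in> measurable M N" "distr M N f = N"
  shows "class_preserving M N f"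
  using assms by (simp add: class_preserving_def)

lemma class_preserving_iff_emeasure:
  assumes f: "f \<in> measurable M N"
  shows "class_preserving M N f \<longleftrightarrow>
    (\<forall>A\<in>sets N. emeasure M (f -` A \<inter> space M) = 0 \<longleftrightarrow> emeasure N A = 0)"
proof -
  have "A \<in> null_sets (distr M N f) \<longleftrightarrow> A \<in> sets N \<and> emeasure M (f -` A \<inter> space M) = 0" for A
    by (cases "A \<in> sets N") (simp_all add: null_sets_def emeasure_distr f)
  moreover have "A \<in> null_sets N \<longleftrightarrow> A \<in> sets N \<and> emeasure N A = 0" for A
    by (simp add: null_sets_def conj_commute)
  ultimately show ?thesis
    unfolding class_preserving_def set_eq_iff using f by meson
qed

lemma class_preserving_AE:
  assumes "class_preserving M N f" "AE y in N. P y"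
  shows "AE x in M. P (f x)"
proof (rule AE_distrD[of f M N P])
  show "f \<in> measurable M N" using assms(1) by (simp add: class_preserving_def)
  show "AE x in distr M N f. P x"
    using assms by (simp add: class_preserving_def eventually_ae_filter)
qed

lemma class_preserving_AE_iff:
  assumes "class_preserving M N f" "{y \<in> space N. P y} \<in> sets N"
  shows "(AE x in M. P (f x)) \<longleftrightarrow> (AE y in N. P y)"
proof -
  have "(AE x in distr M N f. P x) \<longleftrightarrow> (AE y in N. P y)"
    using assms by (simp add: class_preserving_def eventually_ae_filter)
  with assms show ?thesis
    by (simp add: class_preserving_def AE_distr_iff)
qed

text \<open>The preimage of A is A x R, of measure \<open>emeasure M A * \<infinity>\<close>: the
  pushforward is not \<open>M\<close>, but it vanishes on the same sets.\<close>

lemma class_preserving_fst: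
  assumes "sigma_finite_measure M"
  shows "class_preserving (M \<Otimes>\<^sub>M (lborel :: real measure)) M fst"
proof -
  have "emeasure (M \<Otimes>\<^sub>M lborel) (fst -` A \<inter> space (M \<Otimes>\<^sub>M (lborel :: real measure))) = emeasure M A * \<infinity>"
    if "A \<in> sets M" for A
  proof -
    have "fst -` A \<inter> space (M \<Otimes>\<^sub>M (lborel :: real measure)) = A \<times> UNIV"
      using sets.sets_into_space[OF that] by (auto simp: space_pair_measure)
    then show ?thesis
      using lborel.emeasure_pair_measure_Times[OF that, of UNIV] by simp
  qed
  then show ?thesis
    by (auto simp: class_preserving_iff_emeasure ennreal_mult_eq_top_iff)
qed

lemma distr_lborel_translate: "distr lborel lborel (\<lambda>t. t + s) = (lborel :: real measure)"
  using lborel_distr_plus[of s] by (simp add: add.commute cong: distr_cong)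

lemma vertical_flow_measurable [measurable]:
  "vertical_flow s \<in> measurable (M \<Otimes>\<^sub>M lborel) (M \<Otimes>\<^sub>M lborel)"
  by (simp add: vertical_flow_def)

lemma class_preserving_vertical_flow:
  assumes "sigma_finite_measure M"
  shows "class_preserving (M \<Otimes>\<^sub>M lborel) (M \<Otimes>\<^sub>M lborel) (vertical_flow s)"
proof (rule class_preservingI_distr)
  have "distr M M (\<lambda>x. x) \<Otimes>\<^sub>M distr lborel lborel (\<lambda>t::real. t + s) =
      distr (M \<Otimes>\<^sub>M lborel) (M \<Otimes>\<^sub>M lborel) (\<lambda>(x, t). (x, t + s))"
    by (intro pair_measure_distr) (auto simp: distr_lborel_translate lborel.sigma_finite_measure_axioms)
  then show "distr (M \<Otimes>\<^sub>M lborel) (M \<Otimes>\<^sub>M lborel) (vertical_flow s) = M \<Otimes>\<^sub>M lborel"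
    by (simp add: distr_lborel_translate distr_id vertical_flow_def)
qed simp

text \<open>Nonsingularity gives absolute continuity, and densities over a sigma-finite measure are
  unique. An identity between measures is easier to carry to products and along isomorphisms than an
  equation for \<open>RN_deriv\<close>.\<close>

lemma strict_rn_cocycle_iff:
  assumes M: "sigma_finite_measure M" and act: "nonsingular_action M act"
  shows "strict_rn_cocycle M act \<omega> \<longleftrightarrow>
     (\<lambda>(g, x). \<omega> g x) \<in> borel_measurable (borel \<Otimes>\<^sub>M M) \<and>
     (\<forall>g. \<forall>x\<in>space M. 0 < \<omega> g x) \<and>
     (\<forall>g. distr M M (act (- g)) = density M (\<lambda>x. ennreal (\<omega> g x))) \<and>
     (\<forall>g h. \<forall>x\<in>space M. \<omega> (g + h) x = \<omega> g (act h x) * \<omega> h x)"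
proof -
  interpret sigma_finite_measure M by fact
  have "(AE x in M. ennreal (\<omega> g x) = RN_deriv M (distr M M (act (- g))) x) \<longleftrightarrow>
     distr M M (act (- g)) = density M (\<lambda>x. ennreal (\<omega> g x))"
    if m: "(\<lambda>(g, x). \<omega> g x) \<in> borel_measurable (borel \<Otimes>\<^sub>M M)" for g
  proof -
    have [measurable]: "\<omega> g \<in> borel_measurable M"
      using measurable_compose_Pair1[OF _ m, of g] by simp
    have "absolutely_continuous M (distr M M (act (- g)))"
      using act by (auto simp: nonsingular_action_def class_preserving_def absolutely_continuous_def)
    then have d: "density M (RN_deriv M (distr M M (act (- g)))) = distr M M (act (- g))"
      by (intro density_RN_deriv) auto
    have "density M (\<lambda>x. ennreal (\<omega> g x)) = density M (RN_deriv M (distr M M (act (- g)))) \<longleftrightarrow>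
       (AE x in M. ennreal (\<omega> g x) = RN_deriv M (distr M M (act (- g))) x)"
      by (intro density_unique_iff) auto
    then show ?thesis unfolding d by auto
  qed
  then show ?thesis unfolding strict_rn_cocycle_def by blast
qed

lemma measurable_if_borel_action:
  assumes "borel_action M act"
  shows "act g \<in> measurable M M"
proof -
  have "(\<lambda>(g, x). act g x) \<in> measurable (borel \<Otimes>\<^sub>M M) M"
    using assms by (simp add: borel_action_def)
  from measurable_compose_Pair1[OF _ this, of g] show ?thesis by simp
qed

text \<open>\<open>associated_flow\<close> speaks of bounded functions only. Composing with
  \<open>arctan\<close> makes any real function bounded, and \<open>tan\<close> recovers it.\<close>

lemma bounded_arctan_image: "bounded ((\<lambda>z. arctan (f z)) ` S)"
proof (rule boundedI[of _ "pi/2"])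
  fix x assume "x \<in> (\<lambda>z. arctan (f z)) ` S"
  then obtain z where "x = arctan (f z)" by blast
  with arctan_bounded[of "f z"] show "norm x \<le> pi / 2" by (simp only: real_norm_def abs_le_iff) linarith
qed

text \<open>A scaling law under the vertical flow descends along p to the quotient flow. It is used
  with c = 1 for ergodicity and with c = exp(-s) for type III.\<close>

lemma associated_flow_equivariant:
  assumes M: "prob_space M"
    and F: "borel_action N F" and p: "class_preserving (M \<Otimes>\<^sub>M lborel) N p"
    and pF: "\<forall>s. AE z in M \<Otimes>\<^sub>M lborel. p (vertical_flow s z) = F s (p z)"
    and H: "H \<in> borel_measurable N"
    and f: "AE z in M \<Otimes>\<^sub>M lborel. f z = H (p z)"
    and fs: "\<And>z. f (vertical_flow s z) = c * (f z :: real)"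
  shows "AE y in N. H (F s y) = c * H y"
proof -
  note [measurable] = H measurable_if_borel_action[OF F]
  interpret prob_space M by fact
  have "AE z in M \<Otimes>\<^sub>M lborel. f (vertical_flow s z) = H (p (vertical_flow s z))"
    by (rule class_preserving_AE[OF class_preserving_vertical_flow f]) (rule sigma_finite_measure_axioms)
  with f pF[rule_format, of s] have "AE z in M \<Otimes>\<^sub>M lborel. H (F s (p z)) = c * H (p z)"
    by eventually_elim (simp add: fs)
  then show ?thesis
    by (subst (asm) class_preserving_AE_iff[OF p]) auto
qed

text \<open>An invariant function of x, read as a function of (x, t), is invariant under the Maharam
  extension and under the vertical flow. On the quotient it becomes a flow-invariant function, hence
  a constant.\<close>

lemma ergodic_if_associated_flow_ergodic:
  fixes M :: "'x measure" and act :: "'g::{topological_group_add, second_countable_topology, t2_space} \<Rightarrow> 'x \<Rightarrow> 'x"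
  assumes M: "prob_space M" and flow: "associated_flow M act \<omega> N F" and erg: "ergodic N F"
  shows "ergodic M act"
  unfolding ergodic_def
proof safe
  fix f :: "'x \<Rightarrow> real" assume f[measurable]: "f \<in> borel_measurable M" and inv: "invariant_mod M act f"
  interpret prob_space M by fact
  have fst: "class_preserving (M \<Otimes>\<^sub>M (lborel :: real measure)) M fst"
    by (rule class_preserving_fst) (rule sigma_finite_measure_axioms)
  obtain p where N: "borel_action N F"
    and p: "class_preserving (M \<Otimes>\<^sub>M lborel) N p"
    and pF: "\<forall>s. AE z in M \<Otimes>\<^sub>M lborel. p (vertical_flow s z) = F s (p z)"
    and onto: "\<And>f :: 'x \<times> real \<Rightarrow> real.
             f \<in> borel_measurable (M \<Otimes>\<^sub>M lborel) \<Longrightarrow> bounded (f ` space (M \<Otimes>\<^sub>M lborel)) \<Longrightarrow>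
             invariant_mod (M \<Otimes>\<^sub>M lborel) (maharam_act act \<omega>) f \<Longrightarrow>
             \<exists>F \<in> borel_measurable N. AE z in M \<Otimes>\<^sub>M lborel. f z = F (p z)"
    using flow by (auto simp: associated_flow_def nonsingular_action_def)
  let ?f = "\<lambda>z::'x \<times> real. arctan (f (fst z))"
  have "invariant_mod (M \<Otimes>\<^sub>M lborel) (maharam_act act \<omega>) ?f"
    unfolding invariant_mod_def
  proof
    fix g
    have "AE x in M. f (act g x) = f x" using inv by (simp add: invariant_mod_def)
    from class_preserving_AE[OF fst this]
    show "AE z in M \<Otimes>\<^sub>M lborel. ?f (maharam_act act \<omega> g z) = ?f z"
      by eventually_elim (simp add: maharam_act_def split_beta)
  qed
  moreover have "bounded (?f ` S)" for S
    by (rule bounded_arctan_image)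
  ultimately obtain H where H[measurable]: "H \<in> borel_measurable N"
    and fH: "AE z in M \<Otimes>\<^sub>M lborel. ?f z = H (p z)"
    using onto[of ?f] by auto
  have "AE y in N. H (F s y) = 1 * H y" for s
    by (rule associated_flow_equivariant[OF M N p pF H fH]) (simp add: vertical_flow_def split_beta)
  then obtain c where "AE y in N. H y = c"
    using erg[unfolded ergodic_def invariant_mod_def, rule_format, OF H] by auto
  from class_preserving_AE[OF p this] fH have "AE z in M \<Otimes>\<^sub>M (lborel :: real measure). f (fst z) = tan c"
    by eventually_elim (metis tan_arctan)
  then show "\<exists>c. AE x in M. f x = c"
    by (subst (asm) class_preserving_AE_iff[OF fst]) auto
qed

lemma type_III_if_associated_flow_pmp:
  fixes M :: "'x measure" and act :: "'g::{topological_group_add, second_countable_topology, t2_space} \<Rightarrow> 'x \<Rightarrow> 'x"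
  assumes M: "prob_space M" and act: "nonsingular_action M act" and \<omega>: "strict_rn_cocycle M act \<omega>"
    and flow: "associated_flow M act \<omega> N F" and pmp: "\<And>s. distr N N (F s) = N"
  shows "type_III M act"
  unfolding type_III_def
proof (rule notI, elim exE conjE)
  fix \<nu> :: "'x measure"
  assume sets_\<nu>: "sets \<nu> = sets M" and sf: "sigma_finite_measure \<nu>" and ac: "absolutely_continuous M \<nu>"
    and inv: "\<forall>g. distr \<nu> \<nu> (act g) = \<nu>" and nz: "emeasure \<nu> (space M) \<noteq> 0"
  interpret prob_space M by fact
  have sfM: "sigma_finite_measure M" by (rule sigma_finite_measure_axioms)
  have fst: "class_preserving (M \<Otimes>\<^sub>M (lborel :: real measure)) M fst"
    by (rule class_preserving_fst[OF sfM])
  have borel_act: "borel_action M act" using act by (simp add: nonsingular_action_def)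
  note [measurable] = measurable_if_borel_action[OF borel_act]
  have \<omega>_meas: "(\<lambda>(g, x). \<omega> g x) \<in> borel_measurable (borel \<Otimes>\<^sub>M M)"
    and \<omega>_pos: "\<And>g x. x \<in> space M \<Longrightarrow> 0 < \<omega> g x"
    and \<omega>_distr: "\<And>g. distr M M (act (- g)) = density M (\<lambda>x. ennreal (\<omega> g x))"
    using \<omega> unfolding strict_rn_cocycle_iff[OF sfM act] by auto
  have [measurable]: "\<omega> g \<in> borel_measurable M" for g
    using measurable_compose_Pair1[OF _ \<omega>_meas, of g] by simp
  obtain p where N: "borel_action N F" and pN: "prob_space N"
    and p: "class_preserving (M \<Otimes>\<^sub>M lborel) N p"
    and pF: "\<forall>s. AE z in M \<Otimes>\<^sub>M lborel. p (vertical_flow s z) = F s (p z)"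
    and onto: "\<And>f :: 'x \<times> real \<Rightarrow> real.
             f \<in> borel_measurable (M \<Otimes>\<^sub>M lborel) \<Longrightarrow> bounded (f ` space (M \<Otimes>\<^sub>M lborel)) \<Longrightarrow>
             invariant_mod (M \<Otimes>\<^sub>M lborel) (maharam_act act \<omega>) f \<Longrightarrow>
             \<exists>F \<in> borel_measurable N. AE z in M \<Otimes>\<^sub>M lborel. f z = F (p z)"
    using flow by (auto simp: associated_flow_def nonsingular_action_def)
  note [measurable] = measurable_if_borel_action[OF N]
  interpret N: prob_space N by fact
  define \<rho> where "\<rho> = RN_deriv M \<nu>"
  have [measurable]: "\<rho> \<in> borel_measurable M" by (simp add: \<rho>_def)
  have dens: "density M \<rho> = \<nu>" unfolding \<rho>_def by (rule density_RN_deriv[OF ac sets_\<nu>])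
  \<comment> \<open>Since \<open>\<nu>\<close> is sigma-finite its density is finite almost
    everywhere, so passing to \<open>enn2real\<close> below loses nothing.\<close>
  have fin: "AE x in M. \<rho> x \<noteq> \<infinity>" unfolding \<rho>_def by (rule RN_deriv_finite[OF sf ac sets_\<nu>])
  \<comment> \<open>Invariance of \<open>\<nu>\<close> written for its density:
    \<open>\<rho>\<close> is multiplied by 1/\<omega> along the action, exactly as exp(t) is in the
    Maharam extension. Both sides are shown to be densities of \<open>\<nu>\<close>.\<close>
  have \<rho>_act: "AE x in M. \<rho> (act g x) * ennreal (\<omega> g x) = \<rho> x" for g
  proof -
    have act_back: "act g (act (- g) x) = x" if "x \<in> space M" for x
      using borel_act that by (metis borel_action_def add.right_inverse)
    have "density M (\<lambda>x. \<rho> (act g x) * ennreal (\<omega> g x)) =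
        density (density M (\<lambda>x. ennreal (\<omega> g x))) (\<lambda>x. \<rho> (act g x))"
      by (subst density_density_eq) (auto simp: mult.commute)
    also have "\<dots> = distr (density M (\<lambda>x. \<rho> (act g (act (- g) x)))) M (act (- g))"
      unfolding \<omega>_distr[symmetric] by (rule density_distr) auto
    also have "density M (\<lambda>x. \<rho> (act g (act (- g) x))) = \<nu>"
      unfolding dens[symmetric] by (intro density_cong) (auto simp: act_back)
    also have "distr \<nu> M (act (- g)) = \<nu>"
      using inv distr_cong[of \<nu> \<nu> M \<nu> "act (- g)" "act (- g)"] sets_\<nu> by simp
    finally have "density M (\<lambda>x. \<rho> (act g x) * ennreal (\<omega> g x)) = density M \<rho>"
      using dens by simp
    then show ?thesis by (subst (asm) density_unique_iff) auto
  qed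
  \<comment> \<open>An invariant measure with density \<open>\<rho>\<close> makes \<open>\<rho>(x) exp(-t)\<close> invariant under the Maharam
    extension; the vertical flow scales this function, which a measure-preserving flow cannot do.\<close>
  let ?f = "\<lambda>z::'x \<times> real. enn2real (\<rho> (fst z)) * exp (- snd z)"
  let ?af = "\<lambda>z. arctan (?f z)"
  have "invariant_mod (M \<Otimes>\<^sub>M lborel) (maharam_act act \<omega>) ?af"
    unfolding invariant_mod_def
  proof
    fix g
    have "AE x in M. enn2real (\<rho> (act g x)) * \<omega> g x = enn2real (\<rho> x) \<and> \<omega> g x > 0"
      using \<rho>_act[of g] AE_space
    proof eventually_elim
      case (elim x)
      then have "enn2real (\<rho> (act g x) * ennreal (\<omega> g x)) = enn2real (\<rho> x)" by simp
      with \<omega>_pos[of x g] elim show ?case by (metis enn2real_mult enn2real_ennreal less_imp_le)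
    qed
    from class_preserving_AE[OF fst this]
    show "AE z in M \<Otimes>\<^sub>M lborel. ?af (maharam_act act \<omega> g z) = ?af z"
    proof eventually_elim
      case (elim z)
      then have "?f (maharam_act act \<omega> g z) = enn2real (\<rho> (act g (fst z))) * \<omega> g (fst z) * exp (- snd z)"
        by (simp add: maharam_act_def split_beta exp_diff exp_minus field_simps)
      with elim show ?case by simp
    qed
  qed
  moreover have "bounded (?af ` S)" for S
    by (rule bounded_arctan_image)
  ultimately obtain H where H[measurable]: "H \<in> borel_measurable N"
    and fH: "AE z in M \<Otimes>\<^sub>M lborel. ?af z = H (p z)"
    using onto[of ?af] by auto
  \<comment> \<open>Undoes the \<open>arctan\<close>, so that the scaling law, which
    \<open>arctan\<close> destroys, can be stated on \<open>N\<close>.\<close>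
  define K where "K y = tan (H y)" for y
  have K[measurable]: "K \<in> borel_measurable N" unfolding K_def tan_def by simp
  have fK: "AE z in M \<Otimes>\<^sub>M lborel. ?f z = K (p z)"
    using fH by eventually_elim (metis K_def tan_arctan)
  have scale: "AE y in N. K (F s y) = exp (- s) * K y" for s
    by (rule associated_flow_equivariant[OF M N p pF K fK])
      (simp add: vertical_flow_def split_beta exp_diff exp_minus field_simps)
  \<comment> \<open>\<open>K\<close> and its multiple by exp(-s) have the same distribution, because
    \<open>F s\<close> preserves \<open>N\<close>. Hence the measure of a superlevel set does not
    change when its threshold is rescaled.\<close>
  have level: "emeasure N {y\<in>space N. K y > c * exp s} = emeasure N {y\<in>space N. K y > c}" for c s
  proof -
    have "emeasure N {y\<in>space N. K y > c} = emeasure (distr N N (F s)) {y\<in>space N. K y > c}"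
      by (simp add: pmp)
    also have "\<dots> = emeasure N {y\<in>space N. K (F s y) > c}"
      by (subst emeasure_distr) (auto intro!: arg_cong[where f="emeasure N"] dest: measurable_space[OF measurable_if_borel_action[OF N]])
    also have "\<dots> = emeasure N {y\<in>space N. K y > c * exp s}"
    proof (rule emeasure_eq_AE)
      show "AE y in N. (y \<in> {y \<in> space N. c < K (F s y)}) = (y \<in> {y \<in> space N. c * exp s < K y})"
        using scale[of s]
      proof eventually_elim
        case (elim y)
        then have "K y = K (F s y) * exp s" by (simp add: exp_minus field_simps)
        then show ?case by simp
      qed
    qed auto
    finally show ?thesis by simp
  qed
  have null: "emeasure N {y\<in>space N. K y > c} = 0" if "c > 0" for c
  \<comment> \<open>The thresholds c * exp n increase to infinity, so the superlevel sets decrease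
    to the empty set while all having the same finite measure; that measure is 0.\<close>
  proof -
    let ?A = "\<lambda>n::nat. {y\<in>space N. K y > c * exp (real n)}"
    have dec: "decseq ?A"
    proof (intro decseq_SucI subsetI)
      fix n y assume y: "y \<in> ?A (Suc n)"
      have "c * exp (real n) \<le> c * exp (real (Suc n))" using that by simp
      also have "\<dots> < K y" using y by simp
      finally show "y \<in> ?A n" using y by simp
    qed
    have "(\<lambda>n. emeasure N (?A n)) \<longlonglongrightarrow> emeasure N (\<Inter>n. ?A n)"
      by (rule Lim_emeasure_decseq[OF _ dec]) auto
    moreover have "(\<Inter>n. ?A n) = {}"
    proof safe
      fix y assume y: "y \<in> (\<Inter>n. ?A n)"
      obtain n :: nat where n: "K y / c < real n" using reals_Archimedean2 by blast
      have "K y < c * real n" using n that by (simp add: field_simps)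
      also have "\<dots> \<le> c * exp (real n)" using that exp_ge_add_one_self[of "real n"]
        by (intro mult_left_mono) linarith+
      also have "\<dots> < K y" using y by simp
      finally show "y \<in> {}" by simp
    qed
    ultimately show ?thesis
      by (simp add: level LIMSEQ_const_iff)
  qed
  have "AE y in N. \<not> K y > 1 / Suc n" for n
    using null[of "1 / Suc n"] by (subst AE_iff_measurable[OF _ refl]) auto
  then have "AE y in N. \<forall>n. \<not> K y > 1 / Suc n" by (simp add: AE_all_countable)
  then have "AE y in N. K y \<le> 0"
  proof eventually_elim
    case (elim y)
    then show ?case by (metis (full_types) nat_approx_posE not_less not_less_iff_gr_or_eq order.strict_trans)
  qed
  from class_preserving_AE[OF p this] fK
  have "AE z in M \<Otimes>\<^sub>M (lborel :: real measure). enn2real (\<rho> (fst z)) = 0"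
  proof eventually_elim
    case (elim z)
    then have "enn2real (\<rho> (fst z)) \<le> 0" by (metis exp_gt_zero mult_le_0_iff not_less)
    then show ?case by (simp add: order_antisym)
  qed
  then have "AE x in M. enn2real (\<rho> x) = 0"
    by (subst (asm) class_preserving_AE_iff[OF fst]) auto
  with fin have "AE x in M. \<rho> x = 0" by eventually_elim (simp add: enn2real_eq_0_iff)
  then have "emeasure (density M \<rho>) (space M) = 0"
    by (subst emeasure_density) (auto simp: nn_integral_0_iff_AE)
  with nz dens show False by simp
qed

section \<open>Transport to the reals\<close>

text \<open>In a Hausdorff space a point is determined by the basic open sets that contain it, thus
  by a set of naturals; there are as many of these as reals. The map h is an arbitrary injection:
  only the cardinality of the space matters here.\<close>

lemma inj_on_into_real_if_second_countable:
  assumes "second_countable T" "Hausdorff_space T"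
  obtains j :: "'a \<Rightarrow> real" where "inj_on j (topspace T)"
proof -
  obtain \<B> where \<B>: "countable \<B>" "\<And>V. V \<in> \<B> \<Longrightarrow> openin T V"
    and base: "\<And>U x. openin T U \<Longrightarrow> x \<in> U \<Longrightarrow> \<exists>V\<in>\<B>. x \<in> V \<and> V \<subseteq> U"
    using assms(1) unfolding second_countable_def by metis
  obtain h :: "nat set \<Rightarrow> real" where h: "inj h"
    using nat_sets_eqpoll_reals by (auto simp: eqpoll_def bij_betw_def)
  have "inj_on (\<lambda>x. h (to_nat_on \<B> ` {V\<in>\<B>. x \<in> V})) (topspace T)"
  proof (rule inj_onI)
    fix x y assume xy: "x \<in> topspace T" "y \<in> topspace T"
      and "h (to_nat_on \<B> ` {V\<in>\<B>. x \<in> V}) = h (to_nat_on \<B> ` {V\<in>\<B>. y \<in> V})"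
    then have "to_nat_on \<B> ` {V\<in>\<B>. x \<in> V} = to_nat_on \<B> ` {V\<in>\<B>. y \<in> V}"
      using h by (simp add: inj_eq)
    then have same: "{V\<in>\<B>. x \<in> V} = {V\<in>\<B>. y \<in> V}"
      by (subst (asm) inj_on_image_eq_iff[OF inj_on_to_nat_on[OF \<B>(1)]]) auto
    show "x = y"
    proof (rule ccontr)
      assume "x \<noteq> y"
      then obtain U U' where "openin T U" "openin T U'" "x \<in> U" "y \<in> U'" "disjnt U U'"
        using assms(2) xy unfolding Hausdorff_space_def by metis
      with base[of U x] same show False by (auto simp: disjnt_iff)
    qed
  qed
  then show thesis by (rule that)
qed

text \<open>The maps are inverse at every point and not merely almost everywhere, because the axioms
  of \<open>borel_action\<close> and the cocycle identity are demanded at every point.\<close>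

locale measure_iso =
  fixes M :: "'a measure" and W :: "'b measure" and j k
  assumes j[measurable]: "j \<in> measurable M W" and k[measurable]: "k \<in> measurable W M"
    and kj: "x \<in> space M \<Longrightarrow> k (j x) = x" and jk: "w \<in> space W \<Longrightarrow> j (k w) = w"
    and distr_j: "distr M W j = W"
begin

lemma distr_k: "distr W M k = M"
proof -
  have "distr W M k = distr (distr M W j) M k" by (simp add: distr_j)
  also have "\<dots> = distr M M (\<lambda>x. x)"
    by (subst distr_distr[OF k j], rule distr_cong) (auto simp: kj)
  finally show ?thesis by (simp add: distr_id)
qed

lemma class_preserving_j: "class_preserving M W j"
  by (rule class_preservingI_distr) (auto simp: distr_j)

lemma class_preserving_k: "class_preserving W M k"
  by (rule class_preservingI_distr) (auto simp: distr_k)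

lemma AE_iff: "(AE w in W. P w) \<longleftrightarrow> (AE x in M. P (j x))"
proof
  assume "AE x in M. P (j x)"
  from class_preserving_AE[OF class_preserving_k this] AE_space
  show "AE w in W. P w" by eventually_elim (simp add: jk)
qed (rule class_preserving_AE[OF class_preserving_j])

text \<open>The isomorphism extends to the spaces of the Maharam extensions, so that
  \<open>AE_iff\<close> also moves statements about \<open>associated_flow\<close>.\<close>

lemma measure_iso_pair_lborel:
  assumes "sigma_finite_measure M"
  shows "measure_iso (M \<Otimes>\<^sub>M (lborel :: real measure)) (W \<Otimes>\<^sub>M lborel) (map_prod j id) (map_prod k id)"
proof
  show [measurable]: "map_prod j id \<in> M \<Otimes>\<^sub>M lborel \<rightarrow>\<^sub>M W \<Otimes>\<^sub>M (lborel :: real measure)"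
    "map_prod k id \<in> W \<Otimes>\<^sub>M lborel \<rightarrow>\<^sub>M M \<Otimes>\<^sub>M (lborel :: real measure)"
    by (simp_all add: map_prod_def)
  have "distr M W j \<Otimes>\<^sub>M distr lborel lborel (\<lambda>t::real. t) =
      distr (M \<Otimes>\<^sub>M lborel) (W \<Otimes>\<^sub>M lborel) (\<lambda>(x, t). (j x, t))"
    by (intro pair_measure_distr) (auto simp: distr_id lborel.sigma_finite_measure_axioms)
  then show "distr (M \<Otimes>\<^sub>M (lborel :: real measure)) (W \<Otimes>\<^sub>M lborel) (map_prod j id) = W \<Otimes>\<^sub>M lborel"
    by (simp add: distr_j distr_id map_prod_def)
qed (auto simp: space_pair_measure kj jk)

abbreviation transport :: "('g \<Rightarrow> 'a \<Rightarrow> 'a) \<Rightarrow> 'g \<Rightarrow> 'b \<Rightarrow> 'b" where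
  "transport act g \<equiv> \<lambda>w. j (act g (k w))"

lemma borel_action_transport:
  assumes "borel_action M act"
  shows "borel_action W (transport act)"
proof -
  have [measurable]: "(\<lambda>(g, x). act g x) \<in> measurable (borel \<Otimes>\<^sub>M M) M"
    using assms by (simp add: borel_action_def)
  have "(\<lambda>z. case (fst z, k (snd z)) of (g, x) \<Rightarrow> act g x) \<in> measurable (borel \<Otimes>\<^sub>M W) M"
    by measurable
  then have "(\<lambda>(g, w). j (act g (k w))) \<in> measurable (borel \<Otimes>\<^sub>M W) W"
    using measurable_compose[OF _ j] by (auto simp: split_beta')
  moreover have "act g x \<in> space M" if "x \<in> space M" for g x
    using measurable_space[OF measurable_if_borel_action[OF assms] that] .
  ultimately show ?thesis
    using assms measurable_space[OF k] unfolding borel_action_def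
    by (simp add: kj jk)
qed

lemma distr_transport:
  assumes [measurable]: "act g \<in> measurable M M"
  shows "distr W W (transport act g) = distr (distr M M (act g)) W j"
proof -
  have "distr (distr M M (act g)) W j = distr (distr (distr W M k) M (act g)) W j"
    by (simp add: distr_k)
  also have "\<dots> = distr W W (transport act g)"
    by (subst distr_distr, simp, simp)+ (simp add: comp_def)
  finally show ?thesis by simp
qed

lemma nonsingular_action_transport:
  assumes "nonsingular_action M act"
  shows "nonsingular_action W (transport act)"
  unfolding nonsingular_action_def
proof safe
  have b: "borel_action M act" using assms by (simp add: nonsingular_action_def)
  then show "borel_action W (transport act)" by (rule borel_action_transport)
  fix g
  note [measurable] = measurable_if_borel_action[OF b, of g]
  have "null_sets (distr (distr M M (act g)) W j) = null_sets (distr M W j)"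
    using assms
    by (auto simp: nonsingular_action_def class_preserving_def null_sets_distr_iff)
  then show "class_preserving W W (transport act g)"
    by (simp add: class_preserving_def distr_transport distr_j)
qed

lemma stationary_space_transport:
  assumes "stationary_space \<theta> M act" "standard_borel W"
  shows "stationary_space \<theta> W (transport act)"
proof -
  have b: "borel_action M act" and "prob_space M"
    using assms(1) by (simp_all add: stationary_space_def)
  then interpret prob_space M by simp
  have "prob_space W" using prob_space_distr[OF j] by (simp add: distr_j)
  moreover have "(\<integral>\<^sup>+ g. emeasure (distr W W (transport act g)) A \<partial>\<theta>) = emeasure W A"
    if A[measurable]: "A \<in> sets W" for A
  proof -
    have "emeasure (distr W W (transport act g)) A = emeasure (distr M M (act g)) (j -` A \<inter> space M)" for g
      using measurable_if_borel_action[OF b, of g] by (simp add: distr_transport emeasure_distr)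
    moreover have "emeasure W A = emeasure M (j -` A \<inter> space M)"
      by (subst distr_j[symmetric]) (simp add: emeasure_distr)
    ultimately show ?thesis
      using assms(1) measurable_sets[OF j A] by (simp add: stationary_space_def)
  qed
  ultimately show ?thesis
    using assms borel_action_transport[OF b] by (simp add: stationary_space_def)
qed

lemma ergodic_transport:
  assumes "ergodic M act"
  shows "ergodic W (transport act)"
  unfolding ergodic_def
proof safe
  fix f :: "'b \<Rightarrow> real" assume [measurable]: "f \<in> borel_measurable W" and inv: "invariant_mod W (transport act) f"
  have "AE x in M. f (j (act g x)) = f (j x)" for g
  proof -
    have "AE x in M. f (j (act g (k (j x)))) = f (j x)"
      using inv by (simp add: invariant_mod_def AE_iff)
    with AE_space show ?thesis by eventually_elim (simp add: kj)
  qed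
  then have "\<exists>c. AE x in M. f (j x) = c"
    using assms[unfolded ergodic_def, rule_format, of "\<lambda>x. f (j x)"] by (simp add: invariant_mod_def)
  then show "\<exists>c. AE w in W. f w = c" by (simp add: AE_iff)
qed

lemma strict_rn_cocycle_transport:
  assumes M: "sigma_finite_measure M" "sigma_finite_measure W" and act: "nonsingular_action M act"
    and \<omega>: "strict_rn_cocycle M act \<omega>"
  shows "strict_rn_cocycle W (transport act) (\<lambda>g w. \<omega> g (k w))"
proof -
  have b: "borel_action M act" using act by (simp add: nonsingular_action_def)
  note [measurable] = measurable_if_borel_action[OF b]
  have *: "(\<lambda>(g, x). \<omega> g x) \<in> borel_measurable (borel \<Otimes>\<^sub>M M)"
    "\<And>g x. x \<in> space M \<Longrightarrow> 0 < \<omega> g x"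
    "\<And>g. distr M M (act (- g)) = density M (\<lambda>x. ennreal (\<omega> g x))"
    "\<And>g h x. x \<in> space M \<Longrightarrow> \<omega> (g + h) x = \<omega> g (act h x) * \<omega> h x"
    using \<omega> unfolding strict_rn_cocycle_iff[OF M(1) act] by auto
  note [measurable] = *(1)
  have "(\<lambda>z. case (fst z, k (snd z)) of (g, x) \<Rightarrow> \<omega> g x) \<in> borel_measurable (borel \<Otimes>\<^sub>M W)"
    by measurable
  then have m: "(\<lambda>(g, w). \<omega> g (k w)) \<in> borel_measurable (borel \<Otimes>\<^sub>M W)"
    by (simp add: split_beta')
  have [measurable]: "\<omega> g \<in> borel_measurable M" for g
    using measurable_compose_Pair1[OF _ *(1), of g] by simp
  have d: "distr W W (transport act (- g)) = density W (\<lambda>w. ennreal (\<omega> g (k w)))" for g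
  proof -
    have "density W (\<lambda>w. ennreal (\<omega> g (k w))) = density (distr M W j) (\<lambda>w. ennreal (\<omega> g (k w)))"
      by (simp add: distr_j)
    also have "\<dots> = distr (density M (\<lambda>x. ennreal (\<omega> g (k (j x))))) W j"
      by (rule density_distr) auto
    also have "density M (\<lambda>x. ennreal (\<omega> g (k (j x)))) = density M (\<lambda>x. ennreal (\<omega> g x))"
      by (intro density_cong) (auto simp: kj)
    finally show ?thesis by (simp add: distr_transport *(3))
  qed
  have sp: "act h x \<in> space M" if "x \<in> space M" for h x
    using measurable_space[OF measurable_if_borel_action[OF b] that] .
  show ?thesis
    unfolding strict_rn_cocycle_iff[OF M(2) nonsingular_action_transport[OF act]]
    using m d *(2,4) sp measurable_space[OF k] by (auto simp: kj)
qed

text \<open>The flow on \<open>N\<close> stays the same; only the quotient map changes, from p to p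
  after \<open>map_prod k id\<close>. Invariant functions on the new side are pulled back by
  \<open>map_prod j id\<close>.\<close>

lemma associated_flow_transport:
  assumes M: "sigma_finite_measure M" and act: "borel_action M act"
    and flow: "associated_flow M act \<omega> N F"
  shows "associated_flow W (transport act) (\<lambda>g w. \<omega> g (k w)) N F"
proof -
  obtain p where
    p: "class_preserving (M \<Otimes>\<^sub>M lborel) N p"
    and inv: "invariant_mod (M \<Otimes>\<^sub>M lborel) (maharam_act act \<omega>) p"
    and pF: "\<forall>s. AE z in M \<Otimes>\<^sub>M lborel. p (vertical_flow s z) = F s (p z)"
    and onto: "\<And>f :: 'a \<times> real \<Rightarrow> real.
             f \<in> borel_measurable (M \<Otimes>\<^sub>M lborel) \<Longrightarrow> bounded (f ` space (M \<Otimes>\<^sub>M lborel)) \<Longrightarrow>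
             invariant_mod (M \<Otimes>\<^sub>M lborel) (maharam_act act \<omega>) f \<Longrightarrow>
             \<exists>F \<in> borel_measurable N. AE z in M \<Otimes>\<^sub>M lborel. f z = F (p z)"
    using flow by (auto simp: associated_flow_def)
  interpret P: measure_iso "M \<Otimes>\<^sub>M (lborel :: real measure)" "W \<Otimes>\<^sub>M (lborel :: real measure)" "map_prod j id" "map_prod k id"
    by (rule measure_iso_pair_lborel[OF M])
  let ?p = "\<lambda>z. p (map_prod k id z)"
  have pm[measurable]: "p \<in> measurable (M \<Otimes>\<^sub>M lborel) N"
    using p by (simp add: class_preserving_def)
  have sp: "act g x \<in> space M" if "x \<in> space M" for g x
    using measurable_space[OF measurable_if_borel_action[OF act] that] .
  have j_act: "maharam_act (transport act) (\<lambda>g w. \<omega> g (k w)) g (map_prod j id z) =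
      map_prod j id (maharam_act act \<omega> g z)"
    if "z \<in> space (M \<Otimes>\<^sub>M lborel)" for g z
    using that by (auto simp: maharam_act_def space_pair_measure kj)
  have kj_act: "map_prod k id (map_prod j id (maharam_act act \<omega> g z)) = maharam_act act \<omega> g z"
    if "z \<in> space (M \<Otimes>\<^sub>M lborel)" for g z
    using that by (auto simp: maharam_act_def space_pair_measure kj sp)
  have v: "map_prod k id (vertical_flow s (map_prod j id z)) = vertical_flow s z"
    if "z \<in> space (M \<Otimes>\<^sub>M lborel)" for s z
    using that by (auto simp: vertical_flow_def space_pair_measure kj)
  have "distr (W \<Otimes>\<^sub>M lborel) N ?p = distr (distr (W \<Otimes>\<^sub>M lborel) (M \<Otimes>\<^sub>M lborel) (map_prod k id)) N p"
    by (subst distr_distr) (auto simp: comp_def)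
  then have "class_preserving (W \<Otimes>\<^sub>M lborel) N ?p"
    using p by (simp add: class_preserving_def P.distr_k)
  moreover have "invariant_mod (W \<Otimes>\<^sub>M lborel) (maharam_act (transport act) (\<lambda>g w. \<omega> g (k w))) ?p"
    unfolding invariant_mod_def P.AE_iff
  proof
    fix g
    show "AE z in M \<Otimes>\<^sub>M lborel. ?p (maharam_act (transport act) (\<lambda>g w. \<omega> g (k w)) g (map_prod j id z)) =
             ?p (map_prod j id z)"
      using inv[unfolded invariant_mod_def, rule_format, of g] AE_space
      by eventually_elim (simp only: j_act kj_act P.kj)
  qed
  moreover have "AE z in W \<Otimes>\<^sub>M lborel. ?p (vertical_flow s z) = F s (?p z)" for s
    unfolding P.AE_iff using pF[rule_format, of s] AE_space
    by eventually_elim (simp only: v P.kj)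
  moreover have "\<exists>F \<in> borel_measurable N. AE z in W \<Otimes>\<^sub>M lborel. f z = F (?p z)"
    if [measurable]: "f \<in> borel_measurable (W \<Otimes>\<^sub>M lborel)" and bd: "bounded (f ` space (W \<Otimes>\<^sub>M lborel))"
      and finv: "invariant_mod (W \<Otimes>\<^sub>M lborel) (maharam_act (transport act) (\<lambda>g w. \<omega> g (k w))) f"
    for f :: "'b \<times> real \<Rightarrow> real"
  proof -
    let ?f = "\<lambda>z. f (map_prod j id z)"
    have "invariant_mod (M \<Otimes>\<^sub>M lborel) (maharam_act act \<omega>) ?f"
      unfolding invariant_mod_def
    proof
      fix g
      show "AE z in M \<Otimes>\<^sub>M lborel. ?f (maharam_act act \<omega> g z) = ?f z"
        using finv[unfolded invariant_mod_def P.AE_iff, rule_format, of g] AE_space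
        by eventually_elim (simp only: j_act)
    qed
    moreover have "bounded (?f ` space (M \<Otimes>\<^sub>M lborel))"
      by (rule bounded_subset[OF bd]) (use measurable_space[OF P.j] in blast)
    moreover have "?f \<in> borel_measurable (M \<Otimes>\<^sub>M lborel)" by measurable
    ultimately obtain H where H: "H \<in> borel_measurable N" "AE z in M \<Otimes>\<^sub>M lborel. ?f z = H (p z)"
      using onto[of ?f] by blast
    have "AE z in M \<Otimes>\<^sub>M lborel. f (map_prod j id z) = H (?p (map_prod j id z))"
      using H(2) AE_space by eventually_elim (simp only: P.kj)
    with H(1) show ?thesis unfolding P.AE_iff by blast
  qed
  ultimately show ?thesis
    using flow unfolding associated_flow_def by blast
qed

end

text \<open>\<open>standard_borel\<close> asks for some Polish topology on the underlying set, not
  for the usual one of the reals. So the image of any injection j serves as the space, with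
  sigma-algebra and topology pulled back along the inverse k.\<close>

lemma standard_borel_iso_real:
  fixes M :: "'a measure"
  assumes "standard_borel M"
  obtains W :: "real measure" and j k where "measure_iso M W j k" "standard_borel W"
proof -
  obtain T where T: "completely_metrizable_space T" "second_countable T" "topspace T = space M"
    "sets M = sigma_sets (space M) {U. openin T U}"
    using assms by (auto simp: standard_borel_def)
  have "Hausdorff_space T"
    using T(1) completely_metrizable_imp_metrizable_space metrizable_imp_Hausdorff_space by blast
  then obtain j :: "'a \<Rightarrow> real" where inj: "inj_on j (space M)"
    using inj_on_into_real_if_second_countable[OF T(2)] T(3) by metis
  define S where "S = j ` space M"
  define k where "k = inv_into (space M) j"
  have kj: "k (j x) = x" if "x \<in> space M" for x using inj that by (simp add: k_def)
  have jk: "j (k w) = w" if "w \<in> S" for w using that by (auto simp: kj S_def)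
  have kS: "k w \<in> space M" if "w \<in> S" for w using that by (auto simp: kj S_def)
  have jS: "j x \<in> S" if "x \<in> space M" for x using that by (simp add: S_def)
  let ?V = "vimage_algebra S k M"
  have k_meas: "k \<in> measurable ?V M" by (rule measurable_vimage_algebra1) (use kS in auto)
  have j_meas: "j \<in> measurable M ?V"
  proof (rule measurable_vimage_algebra2)
    show "(\<lambda>x. k (j x)) \<in> measurable M M" by (subst measurable_cong[of _ _ "\<lambda>x. x"]) (auto simp: kj)
  qed (use jS in auto)
  let ?W = "distr M ?V j"
  have iso: "measure_iso M ?W j k"
  proof
    show "distr M ?W j = ?W" by (rule distr_cong) simp_all
  qed (simp_all add: j_meas k_meas kj jk)
  let ?T = "pullback_topology S k T"
  have top: "topspace ?T = S" using kS by (auto simp: topspace_pullback_topology T(3))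
  have hom: "homeomorphic_maps T ?T j k"
    unfolding homeomorphic_maps_def
  proof safe
    show "continuous_map ?T T k"
      using continuous_map_pullback[OF continuous_map_id[of T], of S k] by simp
    have "continuous_map T T (k \<circ> j)"
      by (subst continuous_map_eq[OF continuous_map_id]) (auto simp: T(3) kj)
    then show "continuous_map T ?T j"
      by (rule continuous_map_pullback') (auto simp: T(3) jS)
  qed (auto simp: T(3) kj jk top)
  then have hs: "T homeomorphic_space ?T" by (auto simp: homeomorphic_space_def)
  have "second_countable ?T"
    using T(2) homeomorphic_space_second_countability[OF hs] by simp
  moreover have "completely_metrizable_space ?T"
    using T(1) homeomorphic_completely_metrizable_space[OF hs] by simp
  moreover have "sets ?W = sigma_sets (space ?W) {U. openin ?T U}"
  proof -
    have "sets ?W = {k -` A \<inter> S |A. A \<in> sigma_sets (space M) {U. openin T U}}"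
      using kS by (simp add: sets_vimage_algebra2 T(4)[symmetric] Pi_iff)
    also have "\<dots> = sigma_sets S {k -` A \<inter> S |A. A \<in> {U. openin T U}}"
      by (rule sigma_sets_vimage_commute) (use kS in auto)
    also have "{k -` A \<inter> S |A. A \<in> {U. openin T U}} = {U. openin ?T U}"
      by (auto simp: openin_pullback_topology)
    finally show ?thesis by simp
  qed
  ultimately have "standard_borel ?W" unfolding standard_borel_def using top by auto
  with iso show thesis by (rule that)
qed

section \<open>Skew products over the Radon-Nikodym cocycle\<close>

lemma standard_borel_pair:
  assumes M: "standard_borel M" and N: "standard_borel N"
  shows "standard_borel (M \<Otimes>\<^sub>M N)"
proof -
  obtain S where S: "completely_metrizable_space S" "second_countable S" "topspace S = space M"
    "sets M = sigma_sets (space M) {U. openin S U}"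
    using M by (auto simp: standard_borel_def)
  obtain T where T: "completely_metrizable_space T" "second_countable T" "topspace T = space N"
    "sets N = sigma_sets (space N) {U. openin T U}"
    using N by (auto simp: standard_borel_def)
  obtain \<B> where \<B>: "countable \<B>" "\<And>V. V \<in> \<B> \<Longrightarrow> openin S V"
    "\<And>U x. openin S U \<Longrightarrow> x \<in> U \<Longrightarrow> \<exists>V\<in>\<B>. x \<in> V \<and> V \<subseteq> U"
    using S(2) unfolding second_countable_def by metis
  obtain \<C> where \<C>: "countable \<C>" "\<And>V. V \<in> \<C> \<Longrightarrow> openin T V"
    "\<And>U x. openin T U \<Longrightarrow> x \<in> U \<Longrightarrow> \<exists>V\<in>\<C>. x \<in> V \<and> V \<subseteq> U"
    using T(2) unfolding second_countable_def by metis
  \<comment> \<open>A countable base of measurable rectangles. It makes every open set of the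
    product topology a countable union of rectangles, which is the inclusion of sigma-algebras that
    needs second countability.\<close>
  define \<D> where "\<D> = (\<lambda>(V, W). V \<times> W) ` (\<B> \<times> \<C>)"
  have c\<D>: "countable \<D>" using \<B>(1) \<C>(1) by (simp add: \<D>_def)
  have o\<D>: "openin (prod_topology S T) V" if "V \<in> \<D>" for V
    using that \<B>(2) \<C>(2) by (auto simp: \<D>_def openin_prod_Times_iff)
  have b\<D>: "\<exists>V\<in>\<D>. z \<in> V \<and> V \<subseteq> U" if U: "openin (prod_topology S T) U" and z: "z \<in> U" for U z
  proof -
    obtain x y where xy: "z = (x, y)" by (cases z)
    then obtain A B where "openin S A" "openin T B" "x \<in> A" "y \<in> B" "A \<times> B \<subseteq> U"
      using U z unfolding openin_prod_topology_alt by metis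
    moreover obtain V where "V \<in> \<B>" "x \<in> V" "V \<subseteq> A" using \<B>(3) calculation by metis
    moreover obtain W where "W \<in> \<C>" "y \<in> W" "W \<subseteq> B" using \<C>(3) calculation by metis
    ultimately show ?thesis unfolding \<D>_def xy by (intro bexI[of _ "V \<times> W"]) auto
  qed
  have sc: "second_countable (prod_topology S T)"
    unfolding second_countable_def using c\<D> o\<D> b\<D> by (intro exI[of _ \<D>]) auto
  have cm: "completely_metrizable_space (prod_topology S T)"
    using S(1) T(1) by (simp add: completely_metrizable_space_prod_topology)
  let ?\<Omega> = "space M \<times> space N"
  let ?\<Sigma> = "sigma ?\<Omega> {U. openin (prod_topology S T) U}"
  have sub: "{U. openin (prod_topology S T) U} \<subseteq> Pow ?\<Omega>"
    using openin_subset[of "prod_topology S T"] by (auto simp: S(3) T(3))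
  have sets\<Sigma>: "sets ?\<Sigma> = sigma_sets ?\<Omega> {U. openin (prod_topology S T) U}"
    and space\<Sigma>: "space ?\<Sigma> = ?\<Omega>"
    using sub by (simp_all add: sets_measure_of space_measure_of)
  have "sets (M \<Otimes>\<^sub>M N) \<subseteq> sets ?\<Sigma>"
  proof (rule sets_pair_in_sets)
    have f: "fst \<in> measurable ?\<Sigma> M"
    proof (rule measurable_sigma_sets[OF S(4)])
      fix U assume "U \<in> {U. openin S U}"
      then have "openin (prod_topology S T) (U \<times> space N)"
        by (simp add: openin_prod_Times_iff flip: T(3))
      moreover have "fst -` U \<inter> space ?\<Sigma> = U \<times> space N"
        using \<open>U \<in> _\<close> openin_subset[of S U] by (auto simp: space\<Sigma> S(3))
      ultimately show "fst -` U \<inter> space ?\<Sigma> \<in> sets ?\<Sigma>" using sub by auto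
    qed (use openin_subset[of S] in \<open>auto simp: S(3) space\<Sigma>\<close>)
    have s: "snd \<in> measurable ?\<Sigma> N"
    proof (rule measurable_sigma_sets[OF T(4)])
      fix U assume "U \<in> {U. openin T U}"
      then have "openin (prod_topology S T) (space M \<times> U)"
        by (simp add: openin_prod_Times_iff flip: S(3))
      moreover have "snd -` U \<inter> space ?\<Sigma> = space M \<times> U"
        using \<open>U \<in> _\<close> openin_subset[of T U] by (auto simp: space\<Sigma> T(3))
      ultimately show "snd -` U \<inter> space ?\<Sigma> \<in> sets ?\<Sigma>" using sub by auto
    qed (use openin_subset[of T] in \<open>auto simp: T(3) space\<Sigma>\<close>)
    fix a b assume ab: "a \<in> sets M" "b \<in> sets N"
    have "a \<times> b = (fst -` a \<inter> space ?\<Sigma>) \<inter> (snd -` b \<inter> space ?\<Sigma>)"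
      using ab[THEN sets.sets_into_space] by (auto simp: space\<Sigma>)
    also have "\<dots> \<in> sets ?\<Sigma>"
      using ab by (intro sets.Int measurable_sets[OF f] measurable_sets[OF s])
    finally show "a \<times> b \<in> sets ?\<Sigma>" .
  qed
  moreover have "sets ?\<Sigma> \<subseteq> sets (M \<Otimes>\<^sub>M N)"
    unfolding sets\<Sigma>
  proof (rule sets.sigma_sets_subset[of _ "M \<Otimes>\<^sub>M N", unfolded space_pair_measure], rule subsetI)
    fix U assume U: "U \<in> {U. openin (prod_topology S T) U}"
    have "V \<in> sets (M \<Otimes>\<^sub>M N)" if "V \<in> \<D>" for V
    proof -
      obtain A B where AB: "V = A \<times> B" "A \<in> \<B>" "B \<in> \<C>" using \<open>V \<in> \<D>\<close> by (auto simp: \<D>_def)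
      then have "A \<in> sets M" "B \<in> sets N" using \<B>(2) \<C>(2) by (auto simp: S(4) T(4))
      then show ?thesis using AB by simp
    qed
    then have "\<Union>{V\<in>\<D>. V \<subseteq> U} \<in> sets (M \<Otimes>\<^sub>M N)"
      by (intro sets.countable_Union) (auto intro: countable_subset[OF _ c\<D>])
    moreover have "\<Union>{V\<in>\<D>. V \<subseteq> U} = U" using b\<D>[of U] U by auto blast
    ultimately show "U \<in> sets (M \<Otimes>\<^sub>M N)" by simp
  qed
  ultimately have "sets (M \<Otimes>\<^sub>M N) = sigma_sets (space (M \<Otimes>\<^sub>M N)) {U. openin (prod_topology S T) U}"
    by (simp add: sets\<Sigma> space_pair_measure)
  then show ?thesis
    unfolding standard_borel_def using sc cm by (intro exI[of _ "prod_topology S T"]) (auto simp: space_pair_measure S(3) T(3))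
qed

lemma emeasure_vimage_eq_nn_integral:
  assumes "X \<in> measurable P Q" "A \<in> sets Q"
  shows "emeasure P (X -` A \<inter> space P) = (\<integral>\<^sup>+ z. indicator A (X z) \<partial>P)"
proof -
  have "emeasure (distr P Q X) A = (\<integral>\<^sup>+ y. indicator A y \<partial>(distr P Q X))" using assms(2) by simp
  also have "\<dots> = (\<integral>\<^sup>+ z. indicator A (X z) \<partial>P)" by (rule nn_integral_distr) (use assms in auto)
  finally show ?thesis using assms by (simp add: emeasure_distr)
qed

section \<open>The skew product: action, cocycle and stationarity\<close>

definition skew_act ::
  "('g \<Rightarrow> 'x \<Rightarrow> 'x) \<Rightarrow> ('g \<Rightarrow> 'x \<Rightarrow> real) \<Rightarrow> (real \<Rightarrow> 'y \<Rightarrow> 'y) \<Rightarrow> 'g \<Rightarrow> 'x \<times> 'y \<Rightarrow> 'x \<times> 'y" where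
  "skew_act act \<omega> F g = (\<lambda>(x, y). (act g x, F (ln (\<omega> g x)) y))"

locale skew_product = M: prob_space M + N: prob_space N
  for M :: "'x measure" and N :: "'y measure" +
  fixes act :: "'g::{topological_group_add, second_countable_topology, t2_space} \<Rightarrow> 'x \<Rightarrow> 'x"
    and \<omega> :: "'g \<Rightarrow> 'x \<Rightarrow> real" and F :: "real \<Rightarrow> 'y \<Rightarrow> 'y"
  assumes act: "nonsingular_action M act" and \<omega>: "strict_rn_cocycle M act \<omega>"
    and F: "borel_action N F" and pmp: "distr N N (F s) = N"
begin

sublocale pair0: pair_prob_space M N ..
sublocale pair1: pair_sigma_finite M "lborel :: real measure" ..
sublocale pair2: pair_sigma_finite N "lborel :: real measure" ..
sublocale pair3: pair_sigma_finite "M \<Otimes>\<^sub>M N" "lborel :: real measure" ..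
sublocale pair4: pair_sigma_finite "M \<Otimes>\<^sub>M (lborel :: real measure)" N ..

lemma act_borel: "borel_action M act"
  using act by (simp add: nonsingular_action_def)

lemma act_meas: "(\<lambda>z. act (fst z) (snd z)) \<in> measurable (borel \<Otimes>\<^sub>M M) M"
  using act_borel by (simp add: borel_action_def split_beta')

lemma F_meas: "(\<lambda>z. F (fst z) (snd z)) \<in> measurable (borel \<Otimes>\<^sub>M N) N"
  using F by (simp add: borel_action_def split_beta')

lemma \<omega>_meas: "(\<lambda>z. \<omega> (fst z) (snd z)) \<in> borel_measurable (borel \<Otimes>\<^sub>M M)"
  using \<omega> by (simp add: strict_rn_cocycle_def split_beta')

lemma measurable_act [measurable (raw)]:
  "a \<in> measurable P borel \<Longrightarrow> b \<in> measurable P M \<Longrightarrow> (\<lambda>z. act (a z) (b z)) \<in> measurable P M"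
  using measurable_compose[OF measurable_Pair act_meas, of a P b] by simp

lemma measurable_F [measurable (raw)]:
  "a \<in> measurable P borel \<Longrightarrow> b \<in> measurable P N \<Longrightarrow> (\<lambda>z. F (a z) (b z)) \<in> measurable P N"
  using measurable_compose[OF measurable_Pair F_meas, of a P b] by simp

lemma measurable_\<omega> [measurable (raw)]:
  "a \<in> measurable P borel \<Longrightarrow> b \<in> measurable P M \<Longrightarrow> (\<lambda>z. \<omega> (a z) (b z)) \<in> borel_measurable P"
  using measurable_compose[OF measurable_Pair \<omega>_meas, of a P b] by simp

lemma act_space: "x \<in> space M \<Longrightarrow> act g x \<in> space M"
  using measurable_space[OF measurable_if_borel_action[OF act_borel]] .

lemma act_add: "x \<in> space M \<Longrightarrow> act (g + h) x = act g (act h x)"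
  and act_zero: "x \<in> space M \<Longrightarrow> act 0 x = x"
  using act_borel by (auto simp: borel_action_def)

lemma F_add: "y \<in> space N \<Longrightarrow> F (s + t) y = F s (F t y)"
  and F_zero: "y \<in> space N \<Longrightarrow> F 0 y = y"
  using F by (auto simp: borel_action_def)

lemma \<omega>_pos: "x \<in> space M \<Longrightarrow> 0 < \<omega> g x"
  and \<omega>_add: "x \<in> space M \<Longrightarrow> \<omega> (g + h) x = \<omega> g (act h x) * \<omega> h x"
  and \<omega>_distr: "distr M M (act (- g)) = density M (\<lambda>x. ennreal (\<omega> g x))"
  using \<omega> unfolding strict_rn_cocycle_iff[OF M.sigma_finite_measure_axioms act] by auto

lemma \<omega>_zero: "x \<in> space M \<Longrightarrow> \<omega> 0 x = 1"
  using \<omega>_add[of x 0 0] \<omega>_pos[of x 0] by (simp add: act_zero)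

lemma nn_integral_F: "u \<in> borel_measurable N \<Longrightarrow> (\<integral>\<^sup>+ y. u (F s y) \<partial>N) = (\<integral>\<^sup>+ y. u y \<partial>N)"
  by (subst (2) pmp[of s, symmetric], subst nn_integral_distr) auto

abbreviation "sact \<equiv> skew_act act \<omega> F"

lemma measurable_sact_joint: "(\<lambda>(g, z). sact g z) \<in> measurable (borel \<Otimes>\<^sub>M (M \<Otimes>\<^sub>M N)) (M \<Otimes>\<^sub>M N)"
  unfolding skew_act_def split_beta' by measurable

lemma borel_action_sact: "borel_action (M \<Otimes>\<^sub>M N) sact"
  unfolding borel_action_def
proof (intro conjI ballI allI)
  fix z g h assume "z \<in> space (M \<Otimes>\<^sub>M N)"
  then obtain x y where z: "z = (x, y)" "x \<in> space M" "y \<in> space N" by (auto simp: space_pair_measure)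
  then show "sact 0 z = z" by (simp add: skew_act_def act_zero F_zero \<omega>_zero)
  \<comment> \<open>The logarithm turns the multiplicative cocycle identity of
    \<open>\<omega>\<close> into the additive one that matches \<open>F_add\<close>. Its validity at
    every point is what gives an honest action.\<close>
  from z show "sact (g + h) z = sact g (sact h z)"
    by (simp add: skew_act_def act_add \<omega>_add ln_mult_pos \<omega>_pos act_space F_add)
qed (rule measurable_sact_joint)

lemma measurable_sact [measurable]: "sact g \<in> measurable (M \<Otimes>\<^sub>M N) (M \<Otimes>\<^sub>M N)"
  by (rule measurable_if_borel_action[OF borel_action_sact])

text \<open>Over each fixed x the twist is a single map \<open>F s\<close>, which preserves
  \<open>N\<close> and so disappears when y is integrated first. The pushforward of the product
  measure is therefore that of \<open>act\<close> times the identity; nonsingularity, the cocycle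
  and stationarity are all inherited in this way.\<close>

lemma nn_integral_sact:
  assumes [measurable]: "u \<in> borel_measurable (M \<Otimes>\<^sub>M N)"
  shows "(\<integral>\<^sup>+ z. u (sact g z) \<partial>(M \<Otimes>\<^sub>M N)) = (\<integral>\<^sup>+ x. (\<integral>\<^sup>+ y. u (act g x, y) \<partial>N) \<partial>M)"
proof -
  have "(\<integral>\<^sup>+ z. u (sact g z) \<partial>(M \<Otimes>\<^sub>M N)) = (\<integral>\<^sup>+ x. (\<integral>\<^sup>+ y. u (act g x, F (ln (\<omega> g x)) y) \<partial>N) \<partial>M)"
    by (subst N.nn_integral_fst[symmetric]) (auto simp: skew_act_def)
  also have "\<dots> = (\<integral>\<^sup>+ x. (\<integral>\<^sup>+ y. u (act g x, y) \<partial>N) \<partial>M)"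
    using act_space by (intro nn_integral_cong nn_integral_F) measurable
  finally show ?thesis .
qed

lemma emeasure_distr_sact:
  assumes A[measurable]: "A \<in> sets (M \<Otimes>\<^sub>M N)"
  shows "emeasure (distr (M \<Otimes>\<^sub>M N) (M \<Otimes>\<^sub>M N) (sact g)) A =
    (\<integral>\<^sup>+ x. (\<integral>\<^sup>+ y. indicator A (x, y) \<partial>N) \<partial>(distr M M (act g)))"
proof -
  have "emeasure (distr (M \<Otimes>\<^sub>M N) (M \<Otimes>\<^sub>M N) (sact g)) A = (\<integral>\<^sup>+ z. indicator A (sact g z) \<partial>(M \<Otimes>\<^sub>M N))"
    by (subst nn_integral_indicator[symmetric], simp, subst nn_integral_distr) auto
  also have "\<dots> = (\<integral>\<^sup>+ x. (\<integral>\<^sup>+ y. indicator A (act g x, y) \<partial>N) \<partial>M)"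
    by (rule nn_integral_sact) simp
  also have "\<dots> = (\<integral>\<^sup>+ x. (\<integral>\<^sup>+ y. indicator A (x, y) \<partial>N) \<partial>(distr M M (act g)))"
    by (subst nn_integral_distr) auto
  finally show ?thesis .
qed

lemma nonsingular_action_sact: "nonsingular_action (M \<Otimes>\<^sub>M N) sact"
  unfolding nonsingular_action_def
proof safe
  show "borel_action (M \<Otimes>\<^sub>M N) sact" by (rule borel_action_sact)
  fix g
  have cp: "class_preserving M M (act g)" using act by (simp add: nonsingular_action_def)
  have "emeasure (M \<Otimes>\<^sub>M N) (sact g -` A \<inter> space (M \<Otimes>\<^sub>M N)) = 0 \<longleftrightarrow> emeasure (M \<Otimes>\<^sub>M N) A = 0"
    if A[measurable]: "A \<in> sets (M \<Otimes>\<^sub>M N)" for A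
  proof -
    have "emeasure (M \<Otimes>\<^sub>M N) (sact g -` A \<inter> space (M \<Otimes>\<^sub>M N)) = 0 \<longleftrightarrow>
        (AE x in distr M M (act g). (\<integral>\<^sup>+ y. indicator A (x, y) \<partial>N) = 0)"
      using emeasure_distr_sact[OF A, of g] by (simp add: emeasure_distr nn_integral_0_iff_AE)
    also have "\<dots> \<longleftrightarrow> (AE x in M. (\<integral>\<^sup>+ y. indicator A (x, y) \<partial>N) = 0)"
      using cp by (simp add: class_preserving_def eventually_ae_filter)
    also have "\<dots> \<longleftrightarrow> emeasure (M \<Otimes>\<^sub>M N) A = 0"
      by (simp add: N.emeasure_pair_measure nn_integral_0_iff_AE)
    finally show ?thesis .
  qed
  then show "class_preserving (M \<Otimes>\<^sub>M N) (M \<Otimes>\<^sub>M N) (sact g)"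
    by (subst class_preserving_iff_emeasure) auto
qed

lemma strict_rn_cocycle_sact: "strict_rn_cocycle (M \<Otimes>\<^sub>M N) sact (\<lambda>g z. \<omega> g (fst z))"
  unfolding strict_rn_cocycle_iff[OF pair0.P.sigma_finite_measure_axioms nonsingular_action_sact]
proof (intro conjI allI ballI)
  show "(\<lambda>(g, z). \<omega> g (fst z)) \<in> borel_measurable (borel \<Otimes>\<^sub>M (M \<Otimes>\<^sub>M N))"
    unfolding split_beta' by measurable
  fix g
  show "distr (M \<Otimes>\<^sub>M N) (M \<Otimes>\<^sub>M N) (sact (- g)) = density (M \<Otimes>\<^sub>M N) (\<lambda>z. ennreal (\<omega> g (fst z)))"
  proof (rule measure_eqI)
    fix A assume "A \<in> sets (distr (M \<Otimes>\<^sub>M N) (M \<Otimes>\<^sub>M N) (sact (- g)))"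
    then have A[measurable]: "A \<in> sets (M \<Otimes>\<^sub>M N)" by simp
    have "emeasure (distr (M \<Otimes>\<^sub>M N) (M \<Otimes>\<^sub>M N) (sact (- g))) A =
       (\<integral>\<^sup>+ x. \<omega> g x * (\<integral>\<^sup>+ y. indicator A (x, y) \<partial>N) \<partial>M)"
      unfolding emeasure_distr_sact[OF A] \<omega>_distr by (subst nn_integral_density) auto
    also have "\<dots> = (\<integral>\<^sup>+ x. (\<integral>\<^sup>+ y. ennreal (\<omega> g x) * indicator A (x, y) \<partial>N) \<partial>M)"
      by (intro nn_integral_cong nn_integral_cmult[symmetric]) measurable
    also have "\<dots> = (\<integral>\<^sup>+ z. ennreal (\<omega> g (fst z)) * indicator A z \<partial>(M \<Otimes>\<^sub>M N))"
      by (subst N.nn_integral_fst[symmetric]) auto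
    also have "\<dots> = emeasure (density (M \<Otimes>\<^sub>M N) (\<lambda>z. ennreal (\<omega> g (fst z)))) A"
      by (simp add: emeasure_density)
    finally show "emeasure (distr (M \<Otimes>\<^sub>M N) (M \<Otimes>\<^sub>M N) (sact (- g))) A = \<dots>" .
  qed simp
qed (auto simp: space_pair_measure \<omega>_pos \<omega>_add skew_act_def)

lemma stationary_space_sact:
  assumes st: "stationary_space \<theta> M act" and N: "standard_borel N"
    and \<theta>: "prob_space \<theta>" "sets \<theta> = sets borel"
  shows "stationary_space \<theta> (M \<Otimes>\<^sub>M N) sact"
  unfolding stationary_space_def
proof (intro conjI ballI)
  interpret \<theta>: prob_space \<theta> by fact
  interpret \<theta>M: pair_sigma_finite \<theta> M ..
  have [measurable_cong]: "sets \<theta> = sets borel" by fact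
  show "standard_borel (M \<Otimes>\<^sub>M N)"
    using st N by (intro standard_borel_pair) (simp_all add: stationary_space_def)
  show "prob_space (M \<Otimes>\<^sub>M N)" by (rule pair0.P.prob_space_axioms)
  show "borel_action (M \<Otimes>\<^sub>M N) sact" by (rule borel_action_sact)
  \<comment> \<open>Stationarity of \<open>M\<close> says that this pushforward is \<open>M\<close>.
    In this form it applies to integrands, such as the measure of the section of A over x, and not
    only to indicators.\<close>
  let ?D = "distr (\<theta> \<Otimes>\<^sub>M M) M (\<lambda>z. act (fst z) (snd z))"
  have int: "(\<integral>\<^sup>+ x. u x \<partial>?D) = (\<integral>\<^sup>+ g. (\<integral>\<^sup>+ x. u x \<partial>(distr M M (act g))) \<partial>\<theta>)"
    if [measurable]: "u \<in> borel_measurable M" for u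
  proof -
    have "(\<integral>\<^sup>+ x. u x \<partial>?D) = (\<integral>\<^sup>+ z. u (act (fst z) (snd z)) \<partial>(\<theta> \<Otimes>\<^sub>M M))"
      by (subst nn_integral_distr) auto
    also have "\<dots> = (\<integral>\<^sup>+ g. (\<integral>\<^sup>+ x. u (act g x) \<partial>M) \<partial>\<theta>)"
      by (subst M.nn_integral_fst[symmetric]) auto
    also have "\<dots> = (\<integral>\<^sup>+ g. (\<integral>\<^sup>+ x. u x \<partial>(distr M M (act g))) \<partial>\<theta>)"
      by (intro nn_integral_cong) (simp add: nn_integral_distr)
    finally show ?thesis .
  qed
  have D: "?D = M"
  proof (rule measure_eqI)
    fix A assume "A \<in> sets ?D"
    then have A[measurable]: "A \<in> sets M" by simp
    have "emeasure ?D A = (\<integral>\<^sup>+ g. (\<integral>\<^sup>+ x. indicator A x \<partial>(distr M M (act g))) \<partial>\<theta>)"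
      by (subst int[symmetric]) auto
    also have "\<dots> = emeasure M A"
      using st A by (simp add: stationary_space_def)
    finally show "emeasure ?D A = emeasure M A" .
  qed simp
  fix A assume A[measurable]: "A \<in> sets (M \<Otimes>\<^sub>M N)"
  have "(\<integral>\<^sup>+ g. emeasure (distr (M \<Otimes>\<^sub>M N) (M \<Otimes>\<^sub>M N) (sact g)) A \<partial>\<theta>) = (\<integral>\<^sup>+ x. (\<integral>\<^sup>+ y. indicator A (x, y) \<partial>N) \<partial>?D)"
    unfolding emeasure_distr_sact[OF A] by (rule int[symmetric]) measurable
  also have "\<dots> = emeasure (M \<Otimes>\<^sub>M N) A"
    unfolding D by (simp add: N.emeasure_pair_measure)
  finally show "(\<integral>\<^sup>+ g. emeasure (distr (M \<Otimes>\<^sub>M N) (M \<Otimes>\<^sub>M N) (sact g)) A \<partial>\<theta>) = emeasure (M \<Otimes>\<^sub>M N) A" .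
qed

section \<open>Invariant functions on the Maharam extension of the skew product\<close>

definition flow_coord :: "('x \<times> 'y) \<times> real \<Rightarrow> 'y" where
  "flow_coord z = F (snd z) (snd (fst z))"

text \<open>The inverse of the change of coordinates ((x, y), t) to ((x, t), F_t y).\<close>

definition untwist :: "('x \<times> real) \<times> 'y \<Rightarrow> ('x \<times> 'y) \<times> real" where
  "untwist z = ((fst (fst z), F (- snd (fst z)) (snd z)), snd (fst z))"

lemma measurable_flow_coord [measurable]: "flow_coord \<in> measurable ((M \<Otimes>\<^sub>M N) \<Otimes>\<^sub>M lborel) N"
  unfolding flow_coord_def by measurable

lemma measurable_untwist [measurable]:
  "untwist \<in> measurable ((M \<Otimes>\<^sub>M lborel) \<Otimes>\<^sub>M N) ((M \<Otimes>\<^sub>M N) \<Otimes>\<^sub>M lborel)"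
  unfolding untwist_def by measurable

text \<open>Each \<open>F t\<close> preserves \<open>N\<close>, so for every t the slice of the
  preimage of B has measure \<open>emeasure N B\<close>; integrating over t multiplies this by
  infinity.\<close>

lemma class_preserving_flow_coord: "class_preserving ((M \<Otimes>\<^sub>M N) \<Otimes>\<^sub>M lborel) N flow_coord"
proof -
  have "emeasure ((M \<Otimes>\<^sub>M N) \<Otimes>\<^sub>M lborel) (flow_coord -` B \<inter> space ((M \<Otimes>\<^sub>M N) \<Otimes>\<^sub>M lborel)) = emeasure N B * \<infinity>"
    if [measurable]: "B \<in> sets N" for B
  proof -
    have "emeasure ((M \<Otimes>\<^sub>M N) \<Otimes>\<^sub>M lborel) (flow_coord -` B \<inter> space ((M \<Otimes>\<^sub>M N) \<Otimes>\<^sub>M lborel)) =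
        (\<integral>\<^sup>+ z. indicator B (flow_coord z) \<partial>((M \<Otimes>\<^sub>M N) \<Otimes>\<^sub>M lborel))"
      by (rule emeasure_vimage_eq_nn_integral) measurable
    also have "\<dots> = (\<integral>\<^sup>+ t. (\<integral>\<^sup>+ z. indicator B (F t (snd z)) \<partial>(M \<Otimes>\<^sub>M N)) \<partial>lborel)"
      by (subst pair3.nn_integral_snd[symmetric]) (auto simp: flow_coord_def)
    also have "\<dots> = (\<integral>\<^sup>+ t. (\<integral>\<^sup>+ y. indicator B (F t y) \<partial>N) \<partial>(lborel :: real measure))"
      by (subst N.nn_integral_fst[symmetric]) (auto simp: M.emeasure_space_1)
    also have "\<dots> = emeasure N B * \<infinity>"
      by (simp add: nn_integral_F[of "indicator B"])
    finally show ?thesis .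
  qed
  then show ?thesis
    by (auto simp: class_preserving_iff_emeasure ennreal_mult_eq_top_iff)
qed

text \<open>The change of variables acts on y alone once (x, t) is fixed, and there it preserves
  \<open>N\<close>; the rest is the exchange of the integrals over y and t.\<close>

lemma class_preserving_untwist:
  "class_preserving ((M \<Otimes>\<^sub>M lborel) \<Otimes>\<^sub>M N) ((M \<Otimes>\<^sub>M N) \<Otimes>\<^sub>M lborel) untwist"
proof -
  let ?L = "(M \<Otimes>\<^sub>M (lborel :: real measure)) \<Otimes>\<^sub>M N" and ?R = "(M \<Otimes>\<^sub>M N) \<Otimes>\<^sub>M (lborel :: real measure)"
  have "emeasure ?L (untwist -` A \<inter> space ?L) = emeasure ?R A" if A[measurable]: "A \<in> sets ?R" for A
  proof -
    have "emeasure ?L (untwist -` A \<inter> space ?L) = (\<integral>\<^sup>+ z. indicator A (untwist z) \<partial>?L)"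
      by (rule emeasure_vimage_eq_nn_integral) measurable
    also have "\<dots> = (\<integral>\<^sup>+ q. (\<integral>\<^sup>+ y. indicator A ((fst q, F (- snd q) y), snd q) \<partial>N) \<partial>(M \<Otimes>\<^sub>M lborel))"
      by (subst N.nn_integral_fst[symmetric]) (auto simp: untwist_def)
    also have "\<dots> = (\<integral>\<^sup>+ q. (\<integral>\<^sup>+ y. indicator A ((fst q, y), snd q) \<partial>N) \<partial>(M \<Otimes>\<^sub>M lborel))"
      by (intro nn_integral_cong nn_integral_F) (auto simp: space_pair_measure)
    also have "\<dots> = (\<integral>\<^sup>+ x. (\<integral>\<^sup>+ t. (\<integral>\<^sup>+ y. indicator A ((x, y), t) \<partial>N) \<partial>lborel) \<partial>M)"
      by (subst lborel.nn_integral_fst[symmetric]) auto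
    also have "\<dots> = (\<integral>\<^sup>+ x. (\<integral>\<^sup>+ y. (\<integral>\<^sup>+ t. indicator A ((x, y), t) \<partial>lborel) \<partial>N) \<partial>M)"
      by (intro nn_integral_cong pair2.Fubini') measurable
    also have "\<dots> = (\<integral>\<^sup>+ z. (\<integral>\<^sup>+ t. indicator A (z, t) \<partial>lborel) \<partial>(M \<Otimes>\<^sub>M N))"
      by (subst N.nn_integral_fst[symmetric]) auto
    also have "\<dots> = emeasure ?R A"
      by (rule lborel.emeasure_pair_measure[OF A, symmetric])
    finally show ?thesis .
  qed
  then show ?thesis by (auto simp: class_preserving_iff_emeasure)
qed

text \<open>The twist and the shift combine: applying F_{ln \<omega>} after F_{-t} gives F_{-(t - ln
  \<omega>)}, the untwisting at the shifted time. Hence y does not move in the new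
  coordinates.\<close>

lemma maharam_untwist:
  assumes "z \<in> space ((M \<Otimes>\<^sub>M lborel) \<Otimes>\<^sub>M N)"
  shows "maharam_act sact (\<lambda>g z. \<omega> g (fst z)) g (untwist z) = untwist (maharam_act act \<omega> g (fst z), snd z)"
proof -
  obtain x t y where z: "z = ((x, t), y)" "x \<in> space M" "y \<in> space N"
    using assms by (auto simp: space_pair_measure)
  have "F (ln (\<omega> g x)) (F (- t) y) = F (ln (\<omega> g x) - t) y"
    using F_add[of y "ln (\<omega> g x)" "- t"] z by simp
  then show ?thesis using z by (simp add: maharam_act_def untwist_def skew_act_def)
qed

lemma flow_coord_untwist:
  "z \<in> space ((M \<Otimes>\<^sub>M lborel) \<Otimes>\<^sub>M N) \<Longrightarrow> flow_coord (untwist z) = snd z"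
  using F_add[of "snd z" "snd (fst z)" "- snd (fst z)"]
  by (auto simp: flow_coord_def untwist_def F_zero space_pair_measure)

text \<open>The hypothesis makes the measure with density h agree on rectangles with a product of
  \<open>M \<Otimes>\<^sub>M lborel\<close> and a measure on \<open>N\<close>. Equality of the
  measures then forces h to be the density of the second factor, by uniqueness of densities.
  Integrals over sets B replace slices of h, for which invariance is not directly available.\<close>

lemma AE_function_of_second_coordinate:
  fixes h :: "('x \<times> real) \<times> 'y \<Rightarrow> ennreal"
  assumes h[measurable]: "h \<in> borel_measurable ((M \<Otimes>\<^sub>M lborel) \<Otimes>\<^sub>M N)"
    and bound: "\<And>z. z \<in> space ((M \<Otimes>\<^sub>M lborel) \<Otimes>\<^sub>M N) \<Longrightarrow> h z \<le> ennreal C"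
    and const: "\<And>B. B \<in> sets N \<Longrightarrow> \<exists>c. AE q in M \<Otimes>\<^sub>M lborel. (\<integral>\<^sup>+ y. h (q, y) * indicator B y \<partial>N) = c"
  obtains H where "H \<in> borel_measurable N" "AE z in (M \<Otimes>\<^sub>M lborel) \<Otimes>\<^sub>M N. h z = H (snd z)"
proof -
  let ?Q = "M \<Otimes>\<^sub>M (lborel :: real measure)"
  \<comment> \<open>A weight of total mass 1: the measure on \<open>?Q\<close> is infinite, so a
    plain average over it does not exist. The mass is 1 because \<open>M\<close> is a probability
    and the interval has unit length.\<close>
  let ?w = "\<lambda>q::'x \<times> real. indicator {0..1} (snd q) :: ennreal"
  define H where "H y = (\<integral>\<^sup>+ q. ?w q * h (q, y) \<partial>?Q)" for y
  have [measurable]: "H \<in> borel_measurable N" unfolding H_def by measurable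
  have w1: "(\<integral>\<^sup>+ q. ?w q \<partial>?Q) = 1"
    by (subst lborel.nn_integral_fst[symmetric]) (auto simp: M.emeasure_space_1)
  have Hb: "H y \<le> ennreal C" if "y \<in> space N" for y
  proof -
    have "H y \<le> (\<integral>\<^sup>+ q. ?w q * ennreal C \<partial>?Q)"
      unfolding H_def using that by (intro nn_integral_mono mult_left_mono bound) (auto simp: space_pair_measure)
    also have "\<dots> = ennreal C" using w1 by (simp add: nn_integral_multc)
    finally show ?thesis .
  qed
  \<comment> \<open>The bound on h enters here: it makes the second factor finite, hence
    sigma-finite, as the product measure below requires.\<close>
  have fin: "finite_measure (density N H)"
  proof (rule finite_measureI)
    have "emeasure (density N H) (space N) = (\<integral>\<^sup>+ y. H y \<partial>N)"
      by (simp add: emeasure_density cong: nn_integral_cong)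
    also have "\<dots> \<le> (\<integral>\<^sup>+ y. ennreal C \<partial>N)" by (intro nn_integral_mono Hb)
    also have "\<dots> = ennreal C" by (simp add: N.emeasure_space_1)
    finally show "emeasure (density N H) (space (density N H)) \<noteq> \<infinity>"
      by (auto simp: top_unique)
  qed
  \<comment> \<open>Identifies the unknown constant: averaging it against the weight
    \<open>?w\<close> returns it, while Fubini turns the same average into the integral of
    \<open>H\<close> over B.\<close>
  have HB: "AE q in ?Q. (\<integral>\<^sup>+ y. h (q, y) * indicator B y \<partial>N) = emeasure (density N H) B"
    if B[measurable]: "B \<in> sets N" for B
  proof -
    obtain c where c: "AE q in ?Q. (\<integral>\<^sup>+ y. h (q, y) * indicator B y \<partial>N) = c"
      using const[OF B] by blast
    have "emeasure (density N H) B = (\<integral>\<^sup>+ y. (\<integral>\<^sup>+ q. ?w q * h (q, y) * indicator B y \<partial>?Q) \<partial>N)"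
      by (simp only: emeasure_density[OF \<open>H \<in> _\<close> B] H_def, intro nn_integral_cong nn_integral_multc[symmetric])
         measurable
    also have "\<dots> = (\<integral>\<^sup>+ q. (\<integral>\<^sup>+ y. ?w q * h (q, y) * indicator B y \<partial>N) \<partial>?Q)"
      by (rule pair4.Fubini') measurable
    also have "\<dots> = (\<integral>\<^sup>+ q. ?w q * (\<integral>\<^sup>+ y. h (q, y) * indicator B y \<partial>N) \<partial>?Q)"
      by (intro nn_integral_cong) (simp add: mult.assoc nn_integral_cmult)
    also have "\<dots> = (\<integral>\<^sup>+ q. ?w q * c \<partial>?Q)"
      by (rule nn_integral_cong_AE) (use c in eventually_elim, simp)
    also have "\<dots> = c" using w1 by (simp add: nn_integral_multc)
    finally show ?thesis using c by simp
  qed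
  have "?Q \<Otimes>\<^sub>M density N H = density (?Q \<Otimes>\<^sub>M N) h"
  proof (rule pair_measure_eqI)
    fix A B assume A[measurable]: "A \<in> sets ?Q" and "B \<in> sets (density N H)"
    then have B[measurable]: "B \<in> sets N" by simp
    have "emeasure (density (?Q \<Otimes>\<^sub>M N) h) (A \<times> B) = (\<integral>\<^sup>+ z. h z * indicator (A \<times> B) z \<partial>(?Q \<Otimes>\<^sub>M N))"
      by (rule emeasure_density[OF h pair_measureI[OF A B]])
    also have "\<dots> = (\<integral>\<^sup>+ q. (\<integral>\<^sup>+ y. indicator A q * (h (q, y) * indicator B y) \<partial>N) \<partial>?Q)"
      by (subst N.nn_integral_fst[symmetric])
         (auto simp: indicator_times mult_ac)
    also have "\<dots> = (\<integral>\<^sup>+ q. indicator A q * (\<integral>\<^sup>+ y. h (q, y) * indicator B y \<partial>N) \<partial>?Q)"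
      by (intro nn_integral_cong nn_integral_cmult) measurable
    also have "\<dots> = (\<integral>\<^sup>+ q. indicator A q * emeasure (density N H) B \<partial>?Q)"
      by (rule nn_integral_cong_AE) (use HB[OF B] in eventually_elim, simp)
    also have "\<dots> = emeasure ?Q A * emeasure (density N H) B"
      by (subst nn_integral_multc, measurable) (simp only: nn_integral_indicator[OF A])
    finally show "emeasure ?Q A * emeasure (density N H) B = emeasure (density (?Q \<Otimes>\<^sub>M N) h) (A \<times> B)" ..
  qed (auto simp: pair1.P.sigma_finite_measure_axioms finite_measure.axioms(1)[OF fin] cong: sets_pair_measure_cong)
  moreover have "?Q \<Otimes>\<^sub>M density N H = density (?Q \<Otimes>\<^sub>M N) (\<lambda>z. H (snd z))"
    using pair_measure_density[of "\<lambda>_. 1" ?Q H N] fin N.sigma_finite_measure_axioms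
    by (simp add: density_1 split_beta' finite_measure.axioms(1))
  ultimately have "AE z in ?Q \<Otimes>\<^sub>M N. h z = H (snd z)"
    by (subst pair4.P.density_unique_iff[symmetric]) auto
  then show thesis by (intro that[of H]) auto
qed

text \<open>In the untwisted coordinates an invariant function, integrated in y over a set B, is
  invariant under the Maharam extension of \<open>M\<close> and so constant by \<open>erg\<close>.
  The preceding lemma turns this into dependence on y alone, and y is the value of
  \<open>flow_coord\<close>.\<close>

lemma maharam_invariant_factors_through_flow_coord:
  assumes erg: "\<And>f :: 'x \<times> real \<Rightarrow> real.
             f \<in> borel_measurable (M \<Otimes>\<^sub>M lborel) \<Longrightarrow> bounded (f ` space (M \<Otimes>\<^sub>M lborel)) \<Longrightarrow>
             invariant_mod (M \<Otimes>\<^sub>M lborel) (maharam_act act \<omega>) f \<Longrightarrow>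
             \<exists>c. AE z in M \<Otimes>\<^sub>M lborel. f z = c"
    and f[measurable]: "f \<in> borel_measurable ((M \<Otimes>\<^sub>M N) \<Otimes>\<^sub>M lborel)"
    and bd: "bounded (f ` space ((M \<Otimes>\<^sub>M N) \<Otimes>\<^sub>M lborel))"
    and inv: "invariant_mod ((M \<Otimes>\<^sub>M N) \<Otimes>\<^sub>M lborel) (maharam_act sact (\<lambda>g z. \<omega> g (fst z))) f"
  shows "\<exists>H \<in> borel_measurable N. AE z in (M \<Otimes>\<^sub>M N) \<Otimes>\<^sub>M lborel. f z = (H (flow_coord z) :: real)"
proof -
  let ?Q = "M \<Otimes>\<^sub>M (lborel :: real measure)"
  obtain C where C: "\<And>z. z \<in> space ((M \<Otimes>\<^sub>M N) \<Otimes>\<^sub>M lborel) \<Longrightarrow> \<bar>f z\<bar> \<le> C"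
    using bd by (auto simp: bounded_iff)
  \<comment> \<open>Adding the bound C makes the function nonnegative, so that
    \<open>ennreal\<close> truncates nothing; \<open>?H\<close> subtracts it again.\<close>
  define h where "h z = ennreal (f (untwist z) + C)" for z
  have [measurable]: "h \<in> borel_measurable (?Q \<Otimes>\<^sub>M N)" unfolding h_def by measurable
  have hb: "h z \<le> ennreal (2 * C)" if "z \<in> space (?Q \<Otimes>\<^sub>M N)" for z
    unfolding h_def using C[OF measurable_space[OF measurable_untwist that]] by (intro ennreal_leI) linarith
  have const: "\<exists>c. AE q in ?Q. (\<integral>\<^sup>+ y. h (q, y) * indicator B y \<partial>N) = c"
    if B[measurable]: "B \<in> sets N" for B
  proof -
    let ?u = "\<lambda>q. \<integral>\<^sup>+ y. h (q, y) * indicator B y \<partial>N"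
    have ub: "?u q \<le> ennreal (2 * C)" if "q \<in> space ?Q" for q
    proof -
      have "?u q \<le> (\<integral>\<^sup>+ y. ennreal (2 * C) \<partial>N)"
        using that hb by (intro nn_integral_mono) (auto simp: space_pair_measure split: split_indicator)
      then show ?thesis by (simp add: N.emeasure_space_1)
    qed
    then have uf: "?u q < \<infinity>" if "q \<in> space ?Q" for q
      using le_less_trans[OF ub[OF that] ennreal_less_top] by simp
    have "bounded ((\<lambda>q. enn2real (?u q)) ` space ?Q)"
    proof (rule boundedI[of _ "max 0 (2 * C)"])
      fix r assume "r \<in> (\<lambda>q. enn2real (?u q)) ` space ?Q"
      then obtain q where q: "q \<in> space ?Q" "r = enn2real (?u q)" by blast
      have "enn2real (?u q) \<le> enn2real (ennreal (2 * C))" by (intro enn2real_mono ub q) simp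
      then show "norm r \<le> max 0 (2 * C)" using q(2) by (cases "C \<ge> 0") (auto simp: ennreal_neg)
    qed
    moreover have "invariant_mod ?Q (maharam_act act \<omega>) (\<lambda>q. enn2real (?u q))"
      unfolding invariant_mod_def
    proof
      fix g
      have "AE z in ?Q \<Otimes>\<^sub>M N. f (maharam_act sact (\<lambda>g z. \<omega> g (fst z)) g (untwist z)) = f (untwist z)"
        by (rule class_preserving_AE[OF class_preserving_untwist]) (use inv in \<open>simp add: invariant_mod_def\<close>)
      with AE_space have "AE z in ?Q \<Otimes>\<^sub>M N. h (maharam_act act \<omega> g (fst z), snd z) = h z"
        by eventually_elim (simp add: h_def maharam_untwist)
      \<comment> \<open>For this one g, Fubini gives for almost every q an exceptional set that is
        null in y, and the integral over y ignores it.\<close>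
      from pair4.AE_pair[OF this]
      show "AE q in ?Q. enn2real (?u (maharam_act act \<omega> g q)) = enn2real (?u q)"
        by eventually_elim (rule arg_cong[where f=enn2real], rule nn_integral_cong_AE, auto)
    qed
    ultimately obtain c where "AE q in ?Q. enn2real (?u q) = c"
      using erg[of "\<lambda>q. enn2real (?u q)"] by auto
    with AE_space have "AE q in ?Q. ?u q = ennreal c"
      by eventually_elim (use uf in \<open>metis ennreal_enn2real infinity_ennreal_def\<close>)
    then show ?thesis by blast
  qed
  obtain H where [measurable]: "H \<in> borel_measurable N" and H: "AE z in ?Q \<Otimes>\<^sub>M N. h z = H (snd z)"
    using AE_function_of_second_coordinate[of h "2 * C"] hb const by auto
  let ?H = "\<lambda>y. enn2real (H y) - C"
  have "AE z in ?Q \<Otimes>\<^sub>M N. f (untwist z) = ?H (flow_coord (untwist z))"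
    using H AE_space
  proof eventually_elim
    case (elim z)
    then have "0 \<le> f (untwist z) + C"
      using C[OF measurable_space[OF measurable_untwist elim(2)]] by linarith
    then have "enn2real (h z) = f (untwist z) + C" by (simp add: h_def)
    with elim show ?case by (simp add: flow_coord_untwist)
  qed
  moreover have "{z \<in> space ((M \<Otimes>\<^sub>M N) \<Otimes>\<^sub>M lborel). f z = ?H (flow_coord z)} \<in> sets ((M \<Otimes>\<^sub>M N) \<Otimes>\<^sub>M lborel)"
    by measurable
  ultimately have "AE z in (M \<Otimes>\<^sub>M N) \<Otimes>\<^sub>M lborel. f z = ?H (flow_coord z)"
    by (intro class_preserving_AE_iff[OF class_preserving_untwist, THEN iffD1])
  then show ?thesis by (intro bexI[of _ ?H]) auto
qed

end

section \<open>Rotations and linear flows\<close>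

lemma nn_integral_lborel_translate:
  fixes u :: "real \<Rightarrow> ennreal"
  assumes "u \<in> borel_measurable borel"
  shows "(\<integral>\<^sup>+ x. u (x + s) \<partial>lborel) = (\<integral>\<^sup>+ x. u x \<partial>lborel)"
  by (subst (2) distr_lborel_translate[of s, symmetric], subst nn_integral_distr) (use assms in auto)

lemma AE_lborel_translate:
  fixes P :: "real \<Rightarrow> bool"
  assumes "AE x in lborel. P x"
  shows "AE x in lborel. P (x + s)"
  by (rule class_preserving_AE[OF class_preservingI_distr[OF _ distr_lborel_translate] assms]) simp

lemma ex_if_AE_lborel:
  fixes P :: "real \<Rightarrow> bool"
  assumes "AE x in lborel. P x"
  shows "\<exists>x. P x"
proof (rule ccontr)
  assume "\<nexists>x. P x"
  then have "AE x in (lborel :: real measure). False" using assms by simp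
  then have "emeasure lborel (UNIV :: real set) = 0"
    by (subst (asm) AE_iff_measurable[of UNIV]) auto
  then show False by simp
qed

text \<open>Fubini exchanges the quantifiers: some single x satisfies h (x + s) = h x for almost
  every s, and then h equals h x almost everywhere.\<close>

lemma AE_const_if_translation_invariant:
  fixes h :: "real \<Rightarrow> real"
  assumes [measurable]: "h \<in> borel_measurable borel" and inv: "\<And>s. AE x in lborel. h (x + s) = h x"
  shows "\<exists>c. AE x in lborel. h x = c"
proof -
  have "AE s in lborel. AE x in lborel. h (x + s) = h x" using inv by simp
  then have "AE x in lborel. AE s in lborel. h (x + s) = h x"
    by (subst (asm) lborel_pair.AE_commute) measurable
  then obtain x where x: "AE s in lborel. h (x + s) = h x" using ex_if_AE_lborel by blast
  have "AE s in lborel. h s = h x"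
    using AE_lborel_translate[OF x, of "- x"] by simp
  then show ?thesis ..
qed

text \<open>One shifted interval is covered by the other together with two intervals of length |x -
  y| at the endpoints. Each of these has mass at most C |x - y|, whence the factor 2.\<close>

lemma translation_continuity_bounded_density:
  fixes u :: "real \<Rightarrow> real"
  assumes [measurable]: "u \<in> borel_measurable borel" and C: "\<And>x. u x \<le> C" and "C > 0"
  defines "\<nu> \<equiv> density lborel (\<lambda>x. ennreal (u x))"
  shows "emeasure \<nu> {a + x<..<b + x} \<le> emeasure \<nu> {a + y<..<b + y} + ennreal (2 * C * \<bar>x - y\<bar>)"
proof -
  have le: "emeasure \<nu> {l..r} \<le> ennreal (C * (r - l))" if "l \<le> r" for l r
  proof -
    have "emeasure \<nu> {l..r} = (\<integral>\<^sup>+ z. ennreal (u z) * indicator {l..r} z \<partial>lborel)"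
      by (simp add: \<nu>_def emeasure_density)
    also have "\<dots> \<le> (\<integral>\<^sup>+ z. ennreal C * indicator {l..r} z \<partial>lborel)"
      by (intro nn_integral_mono mult_right_mono ennreal_leI C) simp
    also have "\<dots> = ennreal (C * (r - l))"
      using that \<open>C > 0\<close> by (simp add: nn_integral_cmult ennreal_mult)
    finally show ?thesis .
  qed
  have [simp]: "sets \<nu> = sets borel" by (simp add: \<nu>_def)
  let ?J = "\<lambda>c. {c + min x y..c + max x y}"
  have "emeasure \<nu> {a + x<..<b + x} \<le> emeasure \<nu> ({a + y<..<b + y} \<union> (?J a \<union> ?J b))"
    by (intro emeasure_mono) auto
  also have "\<dots> \<le> emeasure \<nu> {a + y<..<b + y} + emeasure \<nu> (?J a \<union> ?J b)"
    by (intro emeasure_subadditive) auto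
  also have "emeasure \<nu> (?J a \<union> ?J b) \<le> emeasure \<nu> (?J a) + emeasure \<nu> (?J b)"
    by (intro emeasure_subadditive) auto
  also have "\<dots> \<le> ennreal (C * \<bar>x - y\<bar>) + ennreal (C * \<bar>x - y\<bar>)"
    using le[of "a + min x y" "a + max x y"] le[of "b + min x y" "b + max x y"]
    by (intro add_mono) (auto simp: max_def min_def abs_if split: if_splits)
  also have "\<dots> = ennreal (2 * C * \<bar>x - y\<bar>)"
    using \<open>C > 0\<close> by (subst ennreal_plus[symmetric]) auto
  finally show ?thesis by (simp add: add_left_mono)
qed

text \<open>A dense set of almost-everywhere periods is upgraded to all translations. The function
  itself need not vary continuously under translation, but the masses it gives to intervals do, once
  it is replaced by a bounded density; these masses determine the density.\<close>

lemma AE_const_if_dense_translation_invariant: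
  fixes h :: "real \<Rightarrow> real"
  assumes h[measurable]: "h \<in> borel_measurable borel"
    and dense: "\<And>t e. e > 0 \<Longrightarrow> \<exists>d. \<bar>d - t\<bar> < e \<and> (AE x in lborel. h (x + d) = h x)"
  shows "\<exists>c. AE x in lborel. h x = c"
proof (rule AE_const_if_translation_invariant[OF h])
  fix t
  \<comment> \<open>Values lie between 0 and pi, so u is a bounded density, and injectivity of
    \<open>arctan\<close> allows a return to h at the end.\<close>
  define u where "u x = arctan (h x) + pi / 2" for x
  have [measurable]: "u \<in> borel_measurable borel" unfolding u_def by measurable
  have u: "0 \<le> u x" "u x \<le> pi" for x
    using arctan_bounded[of "h x"] by (auto simp: u_def)
  define \<nu> where "\<nu> = density lborel (\<lambda>x. ennreal (u x))"
  have shift: "emeasure (density lborel (\<lambda>x. ennreal (u (x + s)))) {a<..<b} = emeasure \<nu> {a + s<..<b + s}" for s a b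
  proof -
    have "emeasure \<nu> {a + s<..<b + s} = (\<integral>\<^sup>+ z. ennreal (u z) * indicator {a + s<..<b + s} z \<partial>lborel)"
      by (simp add: \<nu>_def emeasure_density)
    also have "\<dots> = (\<integral>\<^sup>+ z. ennreal (u (z + s)) * indicator {a + s<..<b + s} (z + s) \<partial>lborel)"
      by (rule nn_integral_lborel_translate[symmetric]) measurable
    also have "\<dots> = emeasure (density lborel (\<lambda>x. ennreal (u (x + s)))) {a<..<b}"
      by (simp add: emeasure_density indicator_def)
    finally show ?thesis ..
  qed
  have eq: "emeasure \<nu> {a + t<..<b + t} = emeasure \<nu> {a<..<b}" for a b
  proof (rule antisym)
    have approx: "\<exists>d. emeasure \<nu> {a + d<..<b + d} = emeasure \<nu> {a<..<b} \<and> 2 * pi * \<bar>t - d\<bar> \<le> e"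
      if "e > 0" for e :: real
    proof -
      \<comment> \<open>The constant 2 pi is 2 C of the continuity estimate, with bound C = pi for
        u.\<close>
      obtain d where d: "\<bar>d - t\<bar> < e / (2 * pi)" "AE x in lborel. h (x + d) = h x"
        using dense[of "e / (2 * pi)" t] \<open>e > 0\<close> by auto
      have "density lborel (\<lambda>x. ennreal (u (x + d))) = \<nu>"
        unfolding \<nu>_def using d(2) by (intro density_cong) (auto simp: u_def)
      then have "emeasure \<nu> {a + d<..<b + d} = emeasure \<nu> {a<..<b}" using shift[of d a b] by simp
      moreover have "2 * pi * \<bar>t - d\<bar> \<le> e" using d(1) by (simp add: field_simps abs_minus_commute)
      ultimately show ?thesis by blast
    qed
    show "emeasure \<nu> {a + t<..<b + t} \<le> emeasure \<nu> {a<..<b}"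
    proof (rule ennreal_le_epsilon)
      fix e :: real assume "0 < e"
      then obtain d where d: "emeasure \<nu> {a + d<..<b + d} = emeasure \<nu> {a<..<b}" "2 * pi * \<bar>t - d\<bar> \<le> e"
        using approx by blast
      have "emeasure \<nu> {a + t<..<b + t} \<le> emeasure \<nu> {a + d<..<b + d} + ennreal (2 * pi * \<bar>t - d\<bar>)"
        unfolding \<nu>_def by (rule translation_continuity_bounded_density) (auto simp: u)
      also have "\<dots> \<le> emeasure \<nu> {a<..<b} + ennreal e"
        unfolding d(1) by (intro add_left_mono ennreal_leI d(2))
      finally show "emeasure \<nu> {a + t<..<b + t} \<le> emeasure \<nu> {a<..<b} + ennreal e" .
    qed
    show "emeasure \<nu> {a<..<b} \<le> emeasure \<nu> {a + t<..<b + t}"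
    proof (rule ennreal_le_epsilon)
      fix e :: real assume "0 < e"
      then obtain d where d: "emeasure \<nu> {a + d<..<b + d} = emeasure \<nu> {a<..<b}" "2 * pi * \<bar>t - d\<bar> \<le> e"
        using approx by blast
      have "emeasure \<nu> {a + d<..<b + d} \<le> emeasure \<nu> {a + t<..<b + t} + ennreal (2 * pi * \<bar>d - t\<bar>)"
        unfolding \<nu>_def by (rule translation_continuity_bounded_density) (auto simp: u)
      also have "\<dots> \<le> emeasure \<nu> {a + t<..<b + t} + ennreal e"
        using d(2) by (intro add_left_mono ennreal_leI) (simp add: abs_minus_commute)
      finally show "emeasure \<nu> {a<..<b} \<le> emeasure \<nu> {a + t<..<b + t} + ennreal e" unfolding d(1) .
    qed
  qed
  \<comment> \<open>Open intervals form an intersection-stable generator on which both measures are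
    finite and agree. Uniqueness of densities then gives equality of the functions.\<close>
  have "density lborel (\<lambda>x. ennreal (u (x + t))) = \<nu>"
  proof (rule measure_eqI_generator_eq)
    let ?E = "range (\<lambda>(a, b). {a<..<b::real})"
    show "Int_stable ?E"
      by (auto simp: Int_stable_def Int_greaterThanLessThan)
    show "sets (density lborel (\<lambda>x. ennreal (u (x + t)))) = sigma_sets UNIV ?E" "sets \<nu> = sigma_sets UNIV ?E"
      by (simp_all add: \<nu>_def borel_eq_box[where 'a=real])
    show "range (\<lambda>n. {- real n<..<real n}) \<subseteq> ?E" by auto
    show "(\<Union>n. {- real n<..<real n}) = UNIV"
    proof safe
      fix x :: real
      obtain n :: nat where "\<bar>x\<bar> < real n" using reals_Archimedean2 by blast
      then show "x \<in> (\<Union>n. {- real n<..<real n})" by (intro UN_I[of n]) auto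
    qed auto
    fix n
    have "emeasure \<nu> {- real n<..<real n} \<le> (\<integral>\<^sup>+ z. ennreal pi * indicator {- real n<..<real n} z \<partial>lborel)"
      unfolding \<nu>_def by (subst emeasure_density) (auto intro!: nn_integral_mono mult_right_mono ennreal_leI u)
    also have "\<dots> < \<infinity>" by (simp add: nn_integral_cmult ennreal_mult_less_top)
    finally show "emeasure (density lborel (\<lambda>x. ennreal (u (x + t)))) {- real n<..<real n} \<noteq> \<infinity>"
      unfolding shift eq by simp
  qed (auto simp: shift eq)
  then have "AE x in lborel. ennreal (u (x + t)) = ennreal (u x)"
    unfolding \<nu>_def by (subst (asm) sigma_finite_measure.density_unique_iff[OF lborel.sigma_finite_measure_axioms]) auto
  then show "AE x in lborel. h (x + t) = h x"
  proof eventually_elim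
    case (elim x)
    then have "arctan (h (x + t)) = arctan (h x)" using u by (simp add: u_def)
    then show ?case by (simp add: arctan_eq_iff)
  qed
qed

text \<open>Kronecker's theorem makes the fractional parts of n L dense in the unit interval; the
  integer m corrects the two integer parts.\<close>

lemma dense_integer_combinations:
  fixes L t e :: real
  assumes "L \<notin> \<rat>" "e > 0"
  shows "\<exists>(m::int) (n::nat). \<bar>(of_int m + of_nat n * L) - t\<bar> < e"
proof -
  have "frac t \<in> closure (range (\<lambda>n. frac (real n * L)))"
    using Kronecker_approx_1[OF assms(1)] by (simp add: frac_lt_1 less_imp_le)
  then obtain n where "\<bar>frac (real n * L) - frac t\<bar> < e"
    using assms(2) by (auto simp: closure_approachable dist_real_def)
  then have "\<bar>(of_int (\<lfloor>t\<rfloor> - \<lfloor>real n * L\<rfloor>) + of_nat n * L) - t\<bar> < e"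
    by (simp add: frac_def algebra_simps)
  then show ?thesis by blast
qed

text \<open>The almost-everywhere periods are closed under addition. With 1, -1 and the irrational L
  among them they are dense.\<close>

lemma AE_const_if_two_periods:
  fixes h :: "real \<Rightarrow> real"
  assumes h[measurable]: "h \<in> borel_measurable borel" and L: "L \<notin> \<rat>"
    and one: "AE x in lborel. h (x + 1) = h x" and period: "AE x in lborel. h (x + L) = h x"
  shows "\<exists>c. AE x in lborel. h x = c"
proof (rule AE_const_if_dense_translation_invariant[OF h])
  let ?S = "{d. AE x in lborel. h (x + d) = h x}"
  have add: "d + d' \<in> ?S" if "d \<in> ?S" "d' \<in> ?S" for d d'
  proof -
    have "AE x in lborel. h (x + d' + d) = h (x + d')"
      using that AE_lborel_translate[of "\<lambda>x. h (x + d) = h x" d'] by simp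
    moreover have "AE x in lborel. h (x + d') = h x" using that by simp
    ultimately have "AE x in lborel. h (x + (d + d')) = h x" by eventually_elim (simp add: ac_simps)
    then show ?thesis by simp
  qed
  have nat: "of_nat n * d \<in> ?S" if "d \<in> ?S" for n d
  proof (induction n)
    case (Suc n)
    then show ?case using add[OF that Suc] by (simp add: algebra_simps)
  qed simp
  have minus: "- 1 \<in> ?S" using AE_lborel_translate[OF one, of "-1"] by (simp add: eq_commute)
  have int: "of_int m \<in> ?S" for m
    using nat[OF minus, of "nat (- m)"] nat[of 1 "nat m"] one by (cases "m \<ge> 0") simp_all
  fix t e :: real assume "e > 0"
  then obtain m :: int and n :: nat where "\<bar>(of_int m + of_nat n * L) - t\<bar> < e"
    using dense_integer_combinations[OF L] by blast
  moreover have "of_int m + of_nat n * L \<in> ?S" by (intro add int nat) (use period in simp)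
  ultimately show "\<exists>d. \<bar>d - t\<bar> < e \<and> (AE x in lborel. h (x + d) = h x)" by blast
qed

section \<open>The circle of circumference L and its rotation flow\<close>

definition circle :: "real \<Rightarrow> real measure" where
  "circle L = density (restrict_space lborel {0..<L}) (\<lambda>_. ennreal (1 / L))"

definition rotation :: "real \<Rightarrow> real \<Rightarrow> real \<Rightarrow> real" where
  "rotation L s y = (y + s) rmod L"

lemma space_circle [simp]: "space (circle L) = {0..<L}"
  by (simp add: circle_def space_restrict_space)

lemma sets_circle [measurable_cong]: "sets (circle L) = sets (restrict_space borel {0..<L})"
  unfolding circle_def sets_density by (rule sets_restrict_space_cong) simp

lemma standard_borel_circle: "standard_borel (circle L)"
proof -
  \<comment> \<open>For positive L the half-open interval is neither open nor closed in the reals.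
    It is open in a closed half-line, and complete metrizability passes to closed and then to open
    subspaces.\<close>
  have "completely_metrizable_space (top_of_set {0::real..})"
    by (intro completely_metrizable_space_closedin completely_metrizable_space_euclidean) simp
  moreover have "openin (top_of_set {0::real..}) ({0..} \<inter> {..<L})"
    by (rule openin_open_Int) simp
  ultimately have "completely_metrizable_space (subtopology (top_of_set {0..}) ({0..} \<inter> {..<L}))"
    by (rule completely_metrizable_space_openin)
  moreover have "{0..} \<inter> ({0..} \<inter> {..<L}) = {0..<L}" by auto
  ultimately have "completely_metrizable_space (top_of_set {0..<L})"
    by (simp only: subtopology_subtopology)
  moreover have "second_countable (top_of_set {0..<L})"
  proof (rule second_countable_subtopology)
    obtain \<B> :: "real set set" where "countable \<B>" "\<And>C. C \<in> \<B> \<Longrightarrow> open C"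
      "\<And>S. open S \<Longrightarrow> \<exists>U. U \<subseteq> \<B> \<and> S = \<Union>U"
      using univ_second_countable by blast
    then show "second_countable (euclidean :: real topology)"
      unfolding second_countable_def by (intro exI[of _ \<B>]) (simp, metis Union_iff Union_upper subset_iff)
  qed
  moreover have "sets (circle L) = sigma_sets {0..<L} {U. openin (top_of_set {0..<L}) U}"
  proof -
    have "sets (circle L) = {id -` A \<inter> {0..<L} |A. A \<in> sigma_sets UNIV {U. open U}}"
      unfolding sets_circle sets_restrict_space by (auto simp: borel_def)
    also have "\<dots> = sigma_sets {0..<L} {id -` A \<inter> {0..<L} |A. A \<in> {U. open U}}"
      by (rule sigma_sets_vimage_commute[of id "{0..<L}" UNIV]) simp
    also have "{id -` A \<inter> {0..<L} |A. A \<in> {U. open U}} = {U. openin (top_of_set {0..<L}) U}"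
      by (auto simp: openin_open)
    finally show ?thesis .
  qed
  ultimately show ?thesis
    unfolding standard_borel_def by (intro exI[of _ "top_of_set {0..<L}"]) simp
qed

lemma measurable_rmod [measurable (raw)]:
  "f \<in> borel_measurable M \<Longrightarrow> (\<lambda>x. f x rmod L) \<in> borel_measurable M"
  unfolding rmod_def
  by (intro borel_measurable_diff borel_measurable_times measurable_compose[OF _ borel_measurable_real_floor]) auto

context
  fixes L :: real assumes L: "L > 0"
begin

lemma rmod_in_circle: "x rmod L \<in> {0..<L}"
  using L by (simp add: rmod_less rmod_nonneg)

lemma measurable_into_circle:
  "f \<in> borel_measurable M \<Longrightarrow> (\<lambda>x. f x rmod L) \<in> measurable M (circle L)"
  using rmod_in_circle
  by (subst measurable_cong_sets[OF refl sets_circle]) (intro measurable_restrict_space2, auto)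

lemma nn_integral_circle:
  assumes u: "u \<in> borel_measurable (circle L)"
  shows "(\<integral>\<^sup>+ y. u y \<partial>circle L) = ennreal (1 / L) * (\<integral>\<^sup>+ y. u y * indicator {0..<L} y \<partial>lborel)"
proof -
  have [measurable]: "u \<in> borel_measurable (restrict_space lborel {0..<L})"
    using u by (simp add: circle_def)
  show ?thesis
    unfolding circle_def by (simp add: nn_integral_density nn_integral_cmult nn_integral_restrict_space)
qed

lemma prob_space_circle: "prob_space (circle L)"
proof
  have "emeasure (circle L) (space (circle L)) = (\<integral>\<^sup>+ y. 1 \<partial>circle L)" by simp
  also have "\<dots> = 1" using L by (subst nn_integral_circle) (auto simp flip: ennreal_mult)
  finally show "emeasure (circle L) (space (circle L)) = 1" .
qed

lemma AE_circle: "(AE y in circle L. P y) \<longleftrightarrow> (AE y in lborel. y \<in> {0..<L} \<longrightarrow> P y)"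
  unfolding circle_def by (subst AE_density, simp, subst AE_restrict_space_iff) (simp_all add: L)

lemma borel_action_rotation: "borel_action (circle L) (rotation L)"
  unfolding borel_action_def
proof (intro conjI ballI allI)
  have [measurable]: "(\<lambda>y. y) \<in> borel_measurable (circle L)"
    by (subst measurable_cong_sets[OF sets_circle refl]) (rule measurable_restrict_space1, simp)
  have "(\<lambda>z. snd z) \<in> borel_measurable (borel \<Otimes>\<^sub>M circle L)"
    by (rule measurable_compose[OF measurable_snd]) measurable
  then show "(\<lambda>(s, y). rotation L s y) \<in> borel \<Otimes>\<^sub>M circle L \<rightarrow>\<^sub>M circle L"
    unfolding rotation_def split_beta' by (intro measurable_into_circle borel_measurable_add) simp_all
  fix y assume "y \<in> space (circle L)"
  then show "rotation L 0 y = y" by (simp add: rotation_def)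
next
  fix s t y
  have "((y + t) rmod L + s) rmod L = ((y + t) rmod L rmod L + s rmod L) rmod L"
    by (simp only: rmod_add)
  also have "\<dots> = (y + t + s) rmod L" by (simp only: rmod_rmod rmod_add)
  finally show "rotation L (s + t) y = rotation L s (rotation L t y)"
    by (simp add: rotation_def ac_simps)
qed

lemma rotation_pmp: "distr (circle L) (circle L) (rotation L s) = circle L"
proof (rule measure_eqI)
  note [measurable] = measurable_if_borel_action[OF borel_action_rotation]
  fix A assume "A \<in> sets (distr (circle L) (circle L) (rotation L s))"
  then have A: "A \<in> sets (circle L)" by simp
  then have AL: "A \<subseteq> {0..<L}" using sets.sets_into_space[OF A] by simp
  have [measurable]: "A \<in> sets borel"
    using A AL unfolding sets_circle by (subst (asm) sets_restrict_space_iff) auto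
  define r where "r = s rmod L"
  have r: "0 \<le> r" "r < L" using rmod_in_circle[of s] by (auto simp: r_def)
  \<comment> \<open>Rotation is an exchange of two intervals, each moved by a translation. This
    splits the integral below into two pieces to which translation invariance of Lebesgue measure
    applies.\<close>
  have rot: "rotation L s y = (if y < L - r then y + r else y + (r - L))" if "y \<in> {0..<L}" for y
  proof -
    have "rotation L s y = (y rmod L + s rmod L) rmod L" by (simp add: rotation_def rmod_add)
    also have "\<dots> = (y + r) rmod L" using that by (simp add: r_def)
    also have "\<dots> = (if y < L - r then y + r else y + (r - L))"
      using that r L by (auto intro!: rmod_unique[of _ _ _ 0] rmod_unique[of _ _ _ 1])
    finally show ?thesis .
  qed
  have "emeasure (distr (circle L) (circle L) (rotation L s)) A = emeasure (circle L) (rotation L s -` A \<inter> space (circle L))"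
    using A by (subst emeasure_distr) auto
  also have "\<dots> = (\<integral>\<^sup>+ y. indicator A (rotation L s y) \<partial>circle L)"
    by (rule emeasure_vimage_eq_nn_integral[OF _ A]) measurable
  also have "\<dots> = ennreal (1 / L) * (\<integral>\<^sup>+ y. indicator A (rotation L s y) * indicator {0..<L} y \<partial>lborel)"
    by (rule nn_integral_circle) (use A in measurable)
  also have "(\<integral>\<^sup>+ y. indicator A (rotation L s y) * indicator {0..<L} y \<partial>lborel) =
     (\<integral>\<^sup>+ y. indicator (A \<inter> {r..<L}) (y + r) + indicator (A \<inter> {0..<r}) (y + (r - L)) \<partial>lborel)"
  proof (intro nn_integral_cong)
    fix y
    show "(indicator A (rotation L s y) * indicator {0..<L} y :: ennreal) =
      indicator (A \<inter> {r..<L}) (y + r) + indicator (A \<inter> {0..<r}) (y + (r - L))"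
    proof (cases "y \<in> {0..<L}")
      case True
      then show ?thesis using rot[OF True] r by (auto simp: indicator_def)
    next
      case False
      then show ?thesis using r by (auto simp: indicator_def)
    qed
  qed
  also have "\<dots> = (\<integral>\<^sup>+ y. indicator (A \<inter> {r..<L}) (y + r) \<partial>lborel) + (\<integral>\<^sup>+ y. indicator (A \<inter> {0..<r}) (y + (r - L)) \<partial>lborel)"
    by (rule nn_integral_add) measurable
  also have "\<dots> = (\<integral>\<^sup>+ y. indicator (A \<inter> {r..<L}) y \<partial>lborel) + (\<integral>\<^sup>+ y. indicator (A \<inter> {0..<r}) y \<partial>lborel)"
    by (intro arg_cong2[where f="(+)"] nn_integral_lborel_translate) measurable
  also have "\<dots> = (\<integral>\<^sup>+ y. indicator (A \<inter> {r..<L}) y + indicator (A \<inter> {0..<r}) y \<partial>lborel)"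
    by (rule nn_integral_add[symmetric]) measurable
  also have "\<dots> = (\<integral>\<^sup>+ y. indicator A y * indicator {0..<L} y \<partial>lborel)"
    using AL r by (intro nn_integral_cong) (auto simp: indicator_def)
  also have "ennreal (1 / L) * \<dots> = (\<integral>\<^sup>+ y. indicator A y \<partial>circle L)"
    by (rule nn_integral_circle[symmetric]) (use A in measurable)
  also have "\<dots> = emeasure (circle L) A" using A by simp
  finally show "emeasure (distr (circle L) (circle L) (rotation L s)) A = emeasure (circle L) A" .
qed simp

text \<open>Lets functions on the circle be lifted to periodic functions on the line, where the
  translation arguments apply, and lets almost-everywhere statements come back down.\<close>

lemma class_preserving_rmod: "class_preserving lborel (circle L) (\<lambda>a. a rmod L)"
proof -
  have m: "(\<lambda>a. a rmod L) \<in> measurable lborel (circle L)" by (rule measurable_into_circle) simp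
  have "emeasure lborel ((\<lambda>a. a rmod L) -` A \<inter> space lborel) = 0 \<longleftrightarrow> emeasure (circle L) A = 0"
    if A: "A \<in> sets (circle L)" for A
  proof -
    have AL: "A \<subseteq> {0..<L}" using sets.sets_into_space[OF A] by simp
    have Ab: "A \<in> sets borel"
      using A AL unfolding sets_circle by (subst (asm) sets_restrict_space_iff) auto
    have "(\<lambda>a. a rmod L) -` A \<inter> space lborel \<in> sets lborel" using measurable_sets[OF m A] .
    then have 1: "emeasure lborel ((\<lambda>a. a rmod L) -` A \<inter> space lborel) = 0 \<longleftrightarrow> (AE a in lborel. a rmod L \<notin> A)"
      by (subst AE_iff_measurable) auto
    have "emeasure (circle L) A = 0 \<longleftrightarrow> (AE y in circle L. y \<notin> A)"
      using A AL by (subst AE_iff_measurable[of A]) auto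
    also have "\<dots> \<longleftrightarrow> (AE y in lborel. y \<notin> A)"
      unfolding AE_circle using AL by (intro AE_cong) auto
    also have "\<dots> \<longleftrightarrow> (AE a in lborel. a rmod L \<notin> A)"
    proof
      assume *: "AE y in lborel. y \<notin> A"
      \<comment> \<open>The preimage of A lies in the union of its countably many translates by
        multiples of L.\<close>
      have "AE a in lborel. \<forall>n::int. a + of_int n * L \<notin> A"
        unfolding AE_all_countable using AE_lborel_translate[OF *] by blast
      then show "AE a in lborel. a rmod L \<notin> A"
      proof eventually_elim
        case (elim a)
        have "a rmod L = a + of_int (- \<lfloor>a / L\<rfloor>) * L" using L by (simp add: rmod_def)
        with elim show ?case by metis
      qed
    next
      assume "AE a in lborel. a rmod L \<notin> A"
      then show "AE y in lborel. y \<notin> A"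
      proof eventually_elim
        case (elim a)
        then show ?case using AL by (metis rmod_idem abs_of_pos L subsetD)
      qed
    qed
    finally show ?thesis using 1 by simp
  qed
  then show ?thesis using m by (simp add: class_preserving_iff_emeasure)
qed

lemma rotation_rmod: "rotation L s (a rmod L) = (a + s) rmod L"
  using rmod_add[of "a rmod L" L s] by (simp add: rotation_def rmod_add)

lemma ergodic_rotation: "ergodic (circle L) (rotation L)"
  unfolding ergodic_def
proof safe
  fix f :: "real \<Rightarrow> real" assume f[measurable]: "f \<in> borel_measurable (circle L)"
    and inv: "invariant_mod (circle L) (rotation L) f"
  have m: "(\<lambda>a. a rmod L) \<in> measurable borel (circle L)" by (rule measurable_into_circle) simp
  have "\<exists>c. AE a in lborel. f (a rmod L) = c"
  proof (rule AE_const_if_translation_invariant)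
    show "(\<lambda>a. f (a rmod L)) \<in> borel_measurable borel" using m by measurable
    fix s
    have "AE y in circle L. f (rotation L s y) = f y" using inv by (simp add: invariant_mod_def)
    from class_preserving_AE[OF class_preserving_rmod this]
    show "AE a in lborel. f ((a + s) rmod L) = f (a rmod L)" by (simp add: rotation_rmod)
  qed
  then show "\<exists>c. AE y in circle L. f y = c"
    by (subst (asm) class_preserving_AE_iff[OF class_preserving_rmod]) measurable
qed

text \<open>The model flow for type III with 0 < \<kappa> < 1 lives on unnormalized Lebesgue
  measure. The factor 1 / L does not affect null sets, so the identity is an isomorphism of the two
  flows.\<close>

lemma class_preserving_circle_restrict:
  "class_preserving (circle L) (restrict_space lborel {0..<L}) (\<lambda>y. y)"
  "class_preserving (restrict_space lborel {0..<L}) (circle L) (\<lambda>y. y)"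
proof -
  have s: "sets (circle L) = sets (restrict_space lborel {0..<L})" by (simp add: circle_def)
  have n: "null_sets (circle L) = null_sets (restrict_space lborel {0..<L})"
    using L by (auto simp: circle_def null_sets_density_iff AE_iff_null_sets dest: AE_not_in)
  have d: "distr M N (\<lambda>y. y) = M" if "sets M = sets N" for M N :: "real measure"
    using distr_cong[of M M N M "\<lambda>y. y" "\<lambda>y. y"] that by (simp add: distr_id)
  have m: "(\<lambda>y. y) \<in> measurable M N" if "sets M = sets N" for M N :: "real measure"
    using measurable_cong_sets[OF refl that, of M] measurable_ident[of M] by (simp add: id_def)
  show "class_preserving (circle L) (restrict_space lborel {0..<L}) (\<lambda>y. y)"
    "class_preserving (restrict_space lborel {0..<L}) (circle L) (\<lambda>y. y)"
    using m[OF s] m[OF s[symmetric]] by (simp_all add: class_preserving_def d[OF s] d[OF s[symmetric]] n)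
qed

end

text \<open>Only null sets are preserved, so there is no product formula for pushforwards. Nullity
  of a set is tested through its sections, and one factor is replaced at a time.\<close>

lemma class_preserving_map_pair:
  assumes M': "sigma_finite_measure M'" and N: "sigma_finite_measure N" and N': "sigma_finite_measure N'"
    and f: "class_preserving M M' f" and g: "class_preserving N N' g"
  shows "class_preserving (M \<Otimes>\<^sub>M N) (M' \<Otimes>\<^sub>M N') (\<lambda>(x, y). (f x, g y))"
proof -
  interpret N: sigma_finite_measure N by fact
  interpret N': sigma_finite_measure N' by fact
  have [measurable]: "f \<in> measurable M M'" "g \<in> measurable N N'"
    using f g by (simp_all add: class_preserving_def)
  have X: "(\<lambda>(x, y). (f x, g y)) \<in> measurable (M \<Otimes>\<^sub>M N) (M' \<Otimes>\<^sub>M N')" by measurable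
  have zero: "(\<integral>\<^sup>+ y. indicator A (x, g y) \<partial>N) = 0 \<longleftrightarrow> (\<integral>\<^sup>+ y. indicator A (x, y) \<partial>N') = 0"
    if [measurable]: "A \<in> sets (M' \<Otimes>\<^sub>M N')" and x: "x \<in> space M'" for A x
  proof -
    have m: "(\<lambda>y. indicator A (x, y) :: ennreal) \<in> borel_measurable N'" using x by measurable
    have "(\<integral>\<^sup>+ y. indicator A (x, g y) \<partial>N) = 0 \<longleftrightarrow> (AE y in N. indicator A (x, g y) = (0 :: ennreal))"
      by (rule nn_integral_0_iff_AE) (use x in measurable)
    also have "\<dots> \<longleftrightarrow> (AE y in N'. indicator A (x, y) = (0 :: ennreal))"
      by (rule class_preserving_AE_iff[OF g]) (use m in measurable)
    also have "\<dots> \<longleftrightarrow> (\<integral>\<^sup>+ y. indicator A (x, y) \<partial>N') = 0"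
      by (rule nn_integral_0_iff_AE[symmetric]) (rule m)
    finally show ?thesis .
  qed
  have "emeasure (M \<Otimes>\<^sub>M N) ((\<lambda>(x, y). (f x, g y)) -` A \<inter> space (M \<Otimes>\<^sub>M N)) = 0 \<longleftrightarrow>
      emeasure (M' \<Otimes>\<^sub>M N') A = 0" if A[measurable]: "A \<in> sets (M' \<Otimes>\<^sub>M N')" for A
  proof -
    have "emeasure (M \<Otimes>\<^sub>M N) ((\<lambda>(x, y). (f x, g y)) -` A \<inter> space (M \<Otimes>\<^sub>M N)) =
        (\<integral>\<^sup>+ x. (\<integral>\<^sup>+ y. indicator A (f x, g y) \<partial>N) \<partial>M)"
      unfolding emeasure_vimage_eq_nn_integral[OF X A]
      by (subst N.nn_integral_fst[symmetric]) auto
    then have "emeasure (M \<Otimes>\<^sub>M N) ((\<lambda>(x, y). (f x, g y)) -` A \<inter> space (M \<Otimes>\<^sub>M N)) = 0 \<longleftrightarrow>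
        (AE x in M. (\<integral>\<^sup>+ y. indicator A (f x, g y) \<partial>N) = 0)"
      by (simp add: nn_integral_0_iff_AE)
    also have "\<dots> \<longleftrightarrow> (AE x in M. (\<integral>\<^sup>+ y. indicator A (f x, y) \<partial>N') = 0)"
      by (intro AE_cong zero A) (rule measurable_space[OF \<open>f \<in> measurable M M'\<close>])
    also have "\<dots> \<longleftrightarrow> (AE x in M'. (\<integral>\<^sup>+ y. indicator A (x, y) \<partial>N') = 0)"
      by (rule class_preserving_AE_iff[OF f]) measurable
    also have "\<dots> \<longleftrightarrow> emeasure (M' \<Otimes>\<^sub>M N') A = 0"
      by (simp add: N'.emeasure_pair_measure nn_integral_0_iff_AE)
    finally show ?thesis .
  qed
  then show ?thesis using X by (simp add: class_preserving_iff_emeasure)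
qed

section \<open>The linear flow on the torus\<close>

definition torus :: "real \<Rightarrow> (real \<times> real) measure" where
  "torus L = circle 1 \<Otimes>\<^sub>M circle L"

text \<open>Both coordinates move at unit speed; the irrational slope is encoded in the
  circumferences 1 and L.\<close>

definition torus_flow :: "real \<Rightarrow> real \<Rightarrow> real \<times> real \<Rightarrow> real \<times> real" where
  "torus_flow L s = (\<lambda>(a, b). (rotation 1 s a, rotation L s b))"

context
  fixes L :: real assumes L: "L > 0"
begin

lemma prob_space_torus: "prob_space (torus L)"
proof -
  interpret pair_prob_space "circle 1" "circle L"
    using prob_space_circle[of 1] prob_space_circle[OF L]
    by (simp add: pair_prob_space_def pair_sigma_finite_def prob_space_imp_sigma_finite)
  show ?thesis unfolding torus_def by unfold_locales
qed

lemma borel_action_torus_flow: "borel_action (torus L) (torus_flow L)"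
proof -
  have f1: "(\<lambda>z. fst (snd z)) \<in> measurable (borel \<Otimes>\<^sub>M torus L) (circle 1)"
    and f2: "(\<lambda>z. snd (snd z)) \<in> measurable (borel \<Otimes>\<^sub>M torus L) (circle L)"
    unfolding torus_def by measurable
  have r1: "(\<lambda>z. rotation 1 (fst z) (snd z)) \<in> measurable (borel \<Otimes>\<^sub>M circle 1) (circle 1)"
    and r2: "(\<lambda>z. rotation L (fst z) (snd z)) \<in> measurable (borel \<Otimes>\<^sub>M circle L) (circle L)"
    using borel_action_rotation[OF zero_less_one] borel_action_rotation[OF L]
    by (simp_all add: borel_action_def split_beta')
  have "(\<lambda>z. (rotation 1 (fst z) (fst (snd z)), rotation L (fst z) (snd (snd z)))) \<in>
      measurable (borel \<Otimes>\<^sub>M torus L) (circle 1 \<Otimes>\<^sub>M circle L)"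
    using measurable_compose[OF measurable_Pair[OF measurable_fst f1] r1]
      measurable_compose[OF measurable_Pair[OF measurable_fst f2] r2]
    by (intro measurable_Pair) simp_all
  then have "(\<lambda>(s, z). torus_flow L s z) \<in> measurable (borel \<Otimes>\<^sub>M torus L) (torus L)"
    unfolding torus_flow_def split_beta' by (simp add: torus_def)
  moreover have "torus_flow L 0 z = z" if "z \<in> space (torus L)" for z
  proof -
    obtain a b where z: "z = (a, b)" "a \<in> space (circle 1)" "b \<in> space (circle L)"
      using \<open>z \<in> space (torus L)\<close> unfolding torus_def space_pair_measure by blast
    then have "rotation 1 0 a = a" "rotation L 0 b = b"
      using borel_action_rotation[OF zero_less_one] borel_action_rotation[OF L] unfolding borel_action_def by auto
    with z(1) show ?thesis by (simp add: torus_flow_def)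
  qed
  moreover have "torus_flow L (s + t) z = torus_flow L s (torus_flow L t z)" if "z \<in> space (torus L)" for s t z
  proof -
    obtain a b where z: "z = (a, b)" "a \<in> space (circle 1)" "b \<in> space (circle L)"
      using \<open>z \<in> space (torus L)\<close> unfolding torus_def space_pair_measure by blast
    have "rotation 1 (s + t) a = rotation 1 s (rotation 1 t a)"
      using borel_action_rotation[OF zero_less_one] z(2) unfolding borel_action_def by blast
    moreover have "rotation L (s + t) b = rotation L s (rotation L t b)"
      using borel_action_rotation[OF L] z(3) unfolding borel_action_def by blast
    ultimately show ?thesis by (simp only: z(1) torus_flow_def prod.case)
  qed
  ultimately show ?thesis unfolding borel_action_def by blast
qed

lemma torus_flow_pmp: "distr (torus L) (torus L) (torus_flow L s) = torus L"
  using pair_measure_distr[of "rotation 1 s" "circle 1" "circle 1" "rotation L s" "circle L" "circle L"]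
    measurable_if_borel_action[OF borel_action_rotation[OF zero_less_one]] measurable_if_borel_action[OF borel_action_rotation[OF L]]
    prob_space_imp_sigma_finite[OF prob_space_circle[OF L]]
  by (simp add: rotation_pmp L torus_def torus_flow_def)

text \<open>Lifted to the plane, an invariant function is constant along diagonals, so it is a
  function h of the difference of the coordinates. Periodicity in the two coordinates gives h the
  incommensurable periods 1 and L.\<close>

lemma ergodic_torus_flow:
  assumes irr: "L \<notin> \<rat>"
  shows "ergodic (torus L) (torus_flow L)"
  unfolding ergodic_def
proof safe
  fix f :: "real \<times> real \<Rightarrow> real" assume f[measurable]: "f \<in> borel_measurable (torus L)"
    and inv: "invariant_mod (torus L) (torus_flow L) f"
  let ?r = "\<lambda>(a, b). (a rmod 1, b rmod L)"
  have r: "class_preserving (lborel \<Otimes>\<^sub>M lborel) (torus L) ?r"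
    unfolding torus_def
    by (intro class_preserving_map_pair class_preserving_rmod prob_space_imp_sigma_finite
        prob_space_circle lborel.sigma_finite_measure_axioms) (simp_all add: L)
  have rm: "?r \<in> measurable (borel \<Otimes>\<^sub>M borel) (torus L)"
    using r by (simp add: class_preserving_def cong: measurable_cong_sets)
  define f' where "f' a b = f (a rmod 1, b rmod L)" for a b
  have f'_meas: "(\<lambda>z. f' (fst z) (snd z)) \<in> borel_measurable (borel \<Otimes>\<^sub>M borel)"
    using measurable_compose[OF rm f] by (simp add: f'_def split_beta')
  have [measurable (raw)]: "(\<lambda>z. f' (u z) (v z)) \<in> borel_measurable P"
    if "u \<in> borel_measurable P" "v \<in> borel_measurable P" for u v and P :: "'z measure"
    using measurable_compose[OF measurable_Pair f'_meas] that by simp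
  have per: "f' (a + 1) b = f' a b" "f' a (b + L) = f' a b" for a b
    using rmod_add[of a 1 1, symmetric] rmod_add[of b L L, symmetric] by (simp_all add: f'_def)
  have "AE z in lborel \<Otimes>\<^sub>M lborel. f' (fst z + s) (snd z + s) = f' (fst z) (snd z)" for s
  proof -
    have "AE z in torus L. f (torus_flow L s z) = f z" using inv by (simp add: invariant_mod_def)
    from class_preserving_AE[OF r this] show ?thesis
      by (simp add: f'_def split_beta' torus_flow_def rotation_rmod L)
  qed
  then have inv': "AE s in lborel. AE z in lborel \<Otimes>\<^sub>M lborel. f' (fst z + s) (snd z + s) = f' (fst z) (snd z)"
    by simp
  interpret triple: pair_sigma_finite "lborel :: real measure" "lborel \<Otimes>\<^sub>M lborel :: (real \<times> real) measure" ..
  from inv' have "AE z in lborel \<Otimes>\<^sub>M lborel. AE s in lborel. f' (fst z + s) (snd z + s) = f' (fst z) (snd z)"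
    by (subst (asm) triple.AE_commute) measurable
  \<comment> \<open>The vertical line a = a0 serves as a cross-section to the diagonals: for almost
    every b the value at (a0, b) is the value almost everywhere along the diagonal through that
    point.\<close>
  from ex_if_AE_lborel[OF lborel_pair.AE_pair[OF this]] obtain a0
    where a0: "AE b in lborel. AE s in lborel. f' (a0 + s) (b + s) = f' a0 b"
    by auto
  define h where "h = f' a0"
  have [measurable]: "h \<in> borel_measurable borel" unfolding h_def by measurable
  have "AE s in lborel. AE b in lborel. f' (a0 + s) (b + s) = h b"
    using a0 unfolding h_def by (subst lborel_pair.AE_commute) measurable
  then have "AE s in lborel. AE b in lborel. f' (a0 + s) b = h (b - s)"
  proof eventually_elim
    case (elim s)
    from AE_lborel_translate[OF this, of "- s"] show ?case by simp
  qed
  from AE_lborel_translate[OF this, of "- a0"]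
  \<comment> \<open>The point (a, b) is followed back along its diagonal to the line a = a0.\<close>
  have slice: "AE a in lborel. AE b in lborel. f' a b = h (b - (a - a0))" by simp
  \<comment> \<open>The slices over a and a + 1 are the same function by periodicity, but they show
    h with arguments that differ by 1.\<close>
  have "AE a in (lborel :: real measure). AE b in lborel. h (b + 1) = h b"
    using slice AE_lborel_translate[OF slice, of 1]
  proof eventually_elim
    case (elim a)
    then have "AE b in lborel. h (b - (a + 1 - a0)) = h (b - (a - a0))"
      by eventually_elim (simp add: per)
    from AE_lborel_translate[OF this, of "a + 1 - a0"] show ?case
      by (simp add: algebra_simps eq_commute)
  qed
  then have "AE b in lborel. h (b + 1) = h b" using ex_if_AE_lborel by blast
  moreover have "AE b in lborel. h (b + L) = h b" by (simp add: h_def per)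
  ultimately have "\<exists>c. AE b in lborel. h b = c"
    by (intro AE_const_if_two_periods[OF _ irr]) simp_all
  then obtain c where c: "AE b in lborel. h b = c" ..
  have "AE a in lborel. AE b in lborel. f' a b = c"
    using slice
  proof eventually_elim
    case (elim a)
    with AE_lborel_translate[OF c, of "a0 - a"] show ?case
      by eventually_elim (simp add: algebra_simps)
  qed
  then have "AE z in lborel \<Otimes>\<^sub>M lborel. f' (fst z) (snd z) = c"
    by (subst lborel_pair.AE_pair_iff[symmetric]) measurable
  then have "AE z in lborel \<Otimes>\<^sub>M lborel. f (?r z) = c"
    by (simp add: f'_def split_beta')
  moreover have "{z \<in> space (torus L). f z = c} \<in> sets (torus L)"
    by (rule borel_measurable_eq[OF f]) simp
  ultimately show "\<exists>c. AE z in torus L. f z = c"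
    by (intro exI[of _ c] class_preserving_AE_iff[OF r, THEN iffD1])
qed

text \<open>The first coordinate determines the time up to an integer, so an orbit meets each
  vertical circle in a countable, hence null, set. By Fubini a conull orbit would fill almost all of
  some vertical circle.\<close>

lemma torus_orbit_not_conull: "\<not> (AE z in torus L. z \<in> range (\<lambda>s. torus_flow L s z0))"
proof
  interpret pair_prob_space "circle 1" "circle L"
    using prob_space_circle[of 1] prob_space_circle[OF L]
    by (simp add: pair_prob_space_def pair_sigma_finite_def prob_space_imp_sigma_finite)
  obtain a0 b0 where z0: "z0 = (a0, b0)" by (cases z0)
  assume "AE z in torus L. z \<in> range (\<lambda>s. torus_flow L s z0)"
  then have "AE a in circle 1. AE b in circle L. (a, b) \<in> range (\<lambda>s. torus_flow L s z0)"
    unfolding torus_def by (rule AE_pair)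
  then obtain a where "AE b in circle L. (a, b) \<in> range (\<lambda>s. torus_flow L s z0)"
    using M1.AE_False eventually_mono by (metis (mono_tags, lifting))
  moreover have "b \<in> range (\<lambda>n::int. (b0 + (a - a0 + of_int n)) rmod L)"
    if ab: "(a, b) \<in> range (\<lambda>s. torus_flow L s z0)" for b
  proof -
    obtain s where s: "a = (a0 + s) rmod 1" "b = (b0 + s) rmod L"
      using ab by (auto simp: torus_flow_def rotation_def z0)
    then have "s = a - a0 + of_int \<lfloor>a0 + s\<rfloor>" by (simp add: rmod_def)
    with s(2) show ?thesis by (metis rangeI)
  qed
  ultimately have "AE b in circle L. b \<in> range (\<lambda>n::int. (b0 + (a - a0 + of_int n)) rmod L)"
    by (rule eventually_mono)
  moreover have "AE b in lborel. b \<notin> range (\<lambda>n::int. (b0 + (a - a0 + of_int n)) rmod L)"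
    by (intro AE_not_in countable_imp_null_set_lborel) simp
  ultimately have "AE b in lborel. b \<notin> {0..<L}"
    unfolding AE_circle[OF L] by eventually_elim blast
  then have "emeasure lborel {0..<L} = 0" by (subst (asm) AE_iff_measurable[of "{0..<L}"]) auto
  with L show False by simp
qed

end

lemma ex_properly_ergodic_pmp_flow:
  obtains N :: "real measure" and F where "standard_borel N" "prob_space N" "borel_action N F"
    "\<And>s. distr N N (F s) = N" "properly_ergodic_flow N F"
proof -
  \<comment> \<open>Any positive irrational circumference serves; one exists because an interval is
    uncountable.\<close>
  have "\<not> {0<..<1::real} \<subseteq> \<rat>"
    using countable_subset[OF _ countable_rat] uncountable_open_interval[of 0 "1::real"] by auto
  then obtain L :: real where L: "L > 0" and irr: "L \<notin> \<rat>"
    by (metis subsetI greaterThanLessThan_iff)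
  have "standard_borel (torus L)"
    unfolding torus_def by (intro standard_borel_pair standard_borel_circle)
  then obtain W :: "real measure" and j k where iso: "measure_iso (torus L) W j k" and W: "standard_borel W"
    by (rule standard_borel_iso_real)
  interpret measure_iso "torus L" W j k by fact
  interpret torus: prob_space "torus L" by (rule prob_space_torus[OF L])
  let ?F = "transport (torus_flow L)"
  note meas = measurable_if_borel_action[OF borel_action_torus_flow[OF L]]
  have "prob_space W" using torus.prob_space_distr[OF j] by (simp add: distr_j)
  moreover have "distr W W (?F s) = W" for s
    by (simp add: distr_transport[of "torus_flow L", OF meas] torus_flow_pmp[OF L] distr_j)
  moreover have "\<not> (AE w in W. w \<in> range (\<lambda>s. ?F s w0))" if w0: "w0 \<in> space W" for w0
  proof
    assume "AE w in W. w \<in> range (\<lambda>s. ?F s w0)"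
    then have "AE z in torus L. j z \<in> range (\<lambda>s. ?F s w0)" by (simp add: AE_iff)
    \<comment> \<open>Injectivity of j on the space identifies the transported orbit with an orbit
      on the torus, so a conull orbit would pull back to a conull orbit there.\<close>
    with AE_space have "AE z in torus L. z \<in> range (\<lambda>s. torus_flow L s (k w0))"
    proof eventually_elim
      case (elim z)
      then obtain s where "j z = j (torus_flow L s (k w0))" by auto
      moreover have "torus_flow L s (k w0) \<in> space (torus L)"
        using measurable_space[OF meas] measurable_space[OF k] w0 by blast
      ultimately have "z = torus_flow L s (k w0)" using kj elim(1) by metis
      then show ?case by blast
    qed
    with torus_orbit_not_conull[OF L] show False by blast
  qed
  ultimately show thesis
    using W borel_action_transport[OF borel_action_torus_flow[OF L]]
      ergodic_transport[OF ergodic_torus_flow[OF L irr]]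
    by (intro that[of W ?F]) (auto simp: properly_ergodic_flow_def)
qed

text \<open>Any ergodic flow with an invariant probability measure is realized as an associated
  flow, so the type may be prescribed through F alone. The hypothesis \<open>type\<close> is the
  case distinction of \<open>type_III_sub\<close>.\<close>

lemma ex_stationary_space_with_associated_flow:
  fixes \<theta> :: "'g::{topological_group_add, second_countable_topology, t2_space} measure"
    and M :: "'x measure" and N :: "real measure"
  assumes \<theta>: "measured_group \<theta>"
    and st: "stationary_space \<theta> M act" and III1: "type_III_sub 1 M act"
    and N: "standard_borel N" "prob_space N" "borel_action N F"
    and pmp: "\<And>s. distr N N (F s) = N" and erg: "ergodic N F"
    and type: "(\<kappa> = 1 \<and> trivial_flow N) \<or>
         (0 < \<kappa> \<and> \<kappa> < 1 \<and>
            flow_isomorphic N F (restrict_space lborel {0..< - ln \<kappa>})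
              (\<lambda>s y. (y + s) rmod (- ln \<kappa>))) \<or>
         (\<kappa> = 0 \<and> properly_ergodic_flow N F)"
  shows "\<exists>(W :: real measure) act'.
    stationary_space \<theta> W act' \<and> ergodic W act' \<and> type_III_sub \<kappa> W act'"
proof -
  obtain \<omega> N0 F0 where act: "nonsingular_action M act" and \<omega>: "strict_rn_cocycle M act \<omega>"
    and flow0: "associated_flow M act \<omega> N0 F0" and triv: "trivial_flow N0"
    using III1 by (auto simp: type_III_sub_def)
  obtain y0 where y0: "AE y in N0. y = y0" using triv by (auto simp: trivial_flow_def)
  \<comment> \<open>The space of ergodic components is one point up to null sets, so every bounded
    invariant function, being a function of p, is constant.\<close>
  have maharam_erg: "\<exists>c. AE z in M \<Otimes>\<^sub>M lborel. f z = c"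
    if f: "f \<in> borel_measurable (M \<Otimes>\<^sub>M lborel)" "bounded (f ` space (M \<Otimes>\<^sub>M lborel))"
      "invariant_mod (M \<Otimes>\<^sub>M lborel) (maharam_act act \<omega>) f" for f :: "'x \<times> real \<Rightarrow> real"
  proof -
    obtain p H where p: "class_preserving (M \<Otimes>\<^sub>M lborel) N0 p"
      and H: "AE z in M \<Otimes>\<^sub>M lborel. f z = H (p z)"
      using flow0 f unfolding associated_flow_def by blast
    from class_preserving_AE[OF p y0] H have "AE z in M \<Otimes>\<^sub>M lborel. f z = H y0"
      by eventually_elim simp
    then show ?thesis ..
  qed
  have pM: "prob_space M" using st by (simp add: stationary_space_def)
  interpret skew_product M N act \<omega> F
    using pM N act \<omega> pmp by (simp add: skew_product_def skew_product_axioms_def)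
  have p\<theta>: "prob_space \<theta>" "sets \<theta> = sets borel" using \<theta> by (simp_all add: measured_group_def)
  let ?P = "M \<Otimes>\<^sub>M N" and ?\<omega> = "\<lambda>g z. \<omega> g (fst z)"
  have stP: "stationary_space \<theta> ?P sact" by (rule stationary_space_sact[OF st N(1) p\<theta>])
  have nsN: "nonsingular_action N F"
    unfolding nonsingular_action_def
    using N(3) measurable_if_borel_action[OF N(3)] pmp by (auto intro: class_preservingI_distr)
  have flowP: "associated_flow ?P sact ?\<omega> N F"
    unfolding associated_flow_def
  proof (intro conjI exI[of _ flow_coord] allI impI)
    show "invariant_mod (?P \<Otimes>\<^sub>M lborel) (maharam_act sact ?\<omega>) flow_coord"
      unfolding invariant_mod_def
    proof (intro allI AE_I2)
      fix g z assume "z \<in> space (?P \<Otimes>\<^sub>M (lborel :: real measure))"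
      then obtain x y t where z: "z = ((x, y), t)" "x \<in> space M" "y \<in> space N"
        by (auto simp: space_pair_measure)
      then show "flow_coord (maharam_act sact ?\<omega> g z) = flow_coord z"
        \<comment> \<open>The Maharam shift lowers the time by ln \<omega> while the skew action has
          already advanced y by ln \<omega>.\<close>
        using F_add[of y "t - ln (\<omega> g x)" "ln (\<omega> g x)"]
        by (simp add: flow_coord_def maharam_act_def skew_act_def)
    qed
    show "AE z in ?P \<Otimes>\<^sub>M lborel. flow_coord (vertical_flow s z) = F s (flow_coord z)" for s
    proof (intro AE_I2)
      fix z assume "z \<in> space (?P \<Otimes>\<^sub>M (lborel :: real measure))"
      then show "flow_coord (vertical_flow s z) = F s (flow_coord z)"
        using F_add[of "snd (fst z)" s "snd z"]
        by (auto simp: flow_coord_def vertical_flow_def space_pair_measure ac_simps)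
    qed
    show "\<exists>H\<in>borel_measurable N. AE z in ?P \<Otimes>\<^sub>M lborel. f z = H (flow_coord z)"
      if "f \<in> borel_measurable (?P \<Otimes>\<^sub>M lborel)" "bounded (f ` space (?P \<Otimes>\<^sub>M lborel))"
        "invariant_mod (?P \<Otimes>\<^sub>M lborel) (maharam_act sact ?\<omega>) f" for f :: "('x \<times> real) \<times> real \<Rightarrow> real"
      by (rule maharam_invariant_factors_through_flow_coord[OF maharam_erg that])
  qed (fact N nsN class_preserving_flow_coord)+
  \<comment> \<open>The product lives on pairs, whereas the conclusion asks for a measure on the
    reals.\<close>
  obtain W :: "real measure" and j k where iso: "measure_iso ?P W j k" and W: "standard_borel W"
    using standard_borel_iso_real stP unfolding stationary_space_def by metis
  interpret measure_iso ?P W j k by fact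
  let ?act = "transport sact" and ?\<omega>W = "\<lambda>g w. ?\<omega> g (k w)"
  have stW: "stationary_space \<theta> W ?act" by (rule stationary_space_transport[OF stP W])
  then have pW: "prob_space W" by (simp add: stationary_space_def)
  have sf: "sigma_finite_measure ?P" "sigma_finite_measure W"
    using pW by (auto intro: prob_space_imp_sigma_finite pair0.P.prob_space_axioms)
  have nsW: "nonsingular_action W ?act" by (rule nonsingular_action_transport[OF nonsingular_action_sact])
  have \<omega>W: "strict_rn_cocycle W ?act ?\<omega>W"
    by (rule strict_rn_cocycle_transport[OF sf nonsingular_action_sact strict_rn_cocycle_sact])
  have flowW: "associated_flow W ?act ?\<omega>W N F"
    by (rule associated_flow_transport[OF sf(1) borel_action_sact flowP])
  have ergW: "ergodic W ?act" by (rule ergodic_if_associated_flow_ergodic[OF pW flowW erg])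
  have "type_III W ?act" by (rule type_III_if_associated_flow_pmp[OF pW nsW \<omega>W flowW pmp])
  with nsW ergW \<omega>W flowW type have "type_III_sub \<kappa> W ?act"
    unfolding type_III_sub_def by blast
  with stW ergW show ?thesis by blast
qed

lemma standard_borel_singleton: "standard_borel (count_space {x})"
proof -
  have "sigma_sets {x} (Pow {x}) = Pow {x}"
    using sets.sigma_sets_eq[of "count_space {x}"] by simp
  moreover have "{U. openin (discrete_topology {x}) U} = Pow {x}" by auto
  ultimately show ?thesis
    unfolding standard_borel_def
    by (intro exI[of _ "discrete_topology {x}"])
       (auto simp: completely_metrizable_space_discrete_topology second_countable_discrete_topology simp del: openin_discrete_topology)
qed

theorem mainTheorem6:
  fixes \<theta> :: "'g::{topological_group_add, second_countable_topology, t2_space} measure"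
  assumes "measured_group \<theta>"
    and "\<exists>(M :: 'x measure) act.
           stationary_space \<theta> M act \<and> ergodic M act \<and> type_III_sub 1 M act"
  shows "\<forall>\<kappa>. 0 \<le> \<kappa> \<and> \<kappa> \<le> 1 \<longrightarrow>
           (\<exists>(M :: real measure) act.
              stationary_space \<theta> M act \<and> ergodic M act \<and> type_III_sub \<kappa> M act)"
proof (intro allI impI)
  fix \<kappa> :: real assume \<kappa>: "0 \<le> \<kappa> \<and> \<kappa> \<le> 1"
  obtain M :: "'x measure" and act where st: "stationary_space \<theta> M act" and III1: "type_III_sub 1 M act"
    using assms(2) by blast
  note ex = ex_stationary_space_with_associated_flow[OF assms(1) st III1]
  consider "\<kappa> = 0" | "0 < \<kappa>" "\<kappa> < 1" | "\<kappa> = 1" using \<kappa> by linarith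
  then show "\<exists>(M :: real measure) act.
              stationary_space \<theta> M act \<and> ergodic M act \<and> type_III_sub \<kappa> M act"
  proof cases
    case 1
    obtain N :: "real measure" and F where "standard_borel N" "prob_space N" "borel_action N F"
      "\<And>s. distr N N (F s) = N" "properly_ergodic_flow N F"
      using ex_properly_ergodic_pmp_flow by blast
    then show ?thesis using 1 by (intro ex[of N F]) (auto simp: properly_ergodic_flow_def)
  next
    case 2
    \<comment> \<open>The period prescribed for the flow of type III with parameter \<kappa>; it is
      positive because \<kappa> < 1.\<close>
    define L where "L = - ln \<kappa>"
    have L: "L > 0" using 2 by (simp add: L_def)
    have "flow_isomorphic (circle L) (rotation L) (restrict_space lborel {0..<L}) (\<lambda>s y. (y + s) rmod L)"
      unfolding flow_isomorphic_def
      using class_preserving_circle_restrict[OF L]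
      by (intro exI[of _ "\<lambda>y. y"]) (auto simp: rotation_def)
    then show ?thesis
      using 2 L standard_borel_circle prob_space_circle borel_action_rotation rotation_pmp ergodic_rotation
      by (intro ex[of "circle L" "rotation L"]) (auto simp: L_def)
  next
    case 3
    \<comment> \<open>The given space already has the right type but lives on \<open>'x\<close>. The
      product with a one-point flow, moved to the reals, is a copy of it on the required
      type.\<close>
    let ?N = "count_space {0 :: real}"
    have "prob_space ?N" by (rule prob_spaceI) simp
    moreover have "borel_action ?N (\<lambda>s y. y)" by (simp add: borel_action_def split_beta')
    moreover have "distr ?N ?N (\<lambda>y. y) = ?N" by (simp add: distr_id)
    moreover have "ergodic ?N (\<lambda>(s::real) y. y)"
      by (auto simp: ergodic_def AE_count_space)
    moreover have "trivial_flow ?N" by (auto simp: trivial_flow_def AE_count_space)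
    ultimately show ?thesis
      using 3 standard_borel_singleton by (intro ex[of ?N "\<lambda>s y. y"]) auto
  qed
qed

end
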